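(* Let $\pi:G\to\mathcal{U}(\mathcal{H}_{\pi})$ be a square integrable representation of a unimodular locally compact group $G$ with admissible vectors $g,g_1,g_2\in\mathcal{H}_{\pi}$. Assume we can write $\mathcal{W}_{g}g$ as a convex combination $$\mathcal{W}_{g}g=t\cdot\mathcal{W}_{g_1}g_1+(1-t)\cdot\mathcal{W}_{g_2}g_2$$ for some $t\in[0,1]$. Then $t\in\{0,1\}$ and we either have $g=cg_1$ or $g=cg_2$ for some $c\in\mathbb{T}$.
   Context: $\mathbb{T}=\{z\in\mathbb{C}:|z|=1\}$. Locally compact groups are Hausdorff, $L^2(G)$ is taken with respect to a fixed left Haar measure, and inner products are linear in the first argument; $G$ is unimodular if its left Haar measure is also right-invariant. A unitary representation $\pi:G\to\mathcal{U}(\mathcal{H}_{\pi})$ is a group homomorphism into the unitary operators of a Hilbert space $\mathcal{H}_\pi$ such that for all $f,g\in\mathcal{H}_\pi$ the function (wavelet transform) $\mathcal{W}_{g}f(x):=\langle f,\pi(x)g\rangle_{\mathcal{H}_\pi}$ is continuous on $G$. It is irreducible if its only closed invariant subspaces are $\{0\}$ and $\mathcal{H}_\pi$. A square integrable representation is an irreducible unitary representation $\pi$ for which there is a non-zero $g\in\mathcal{H}_\pi$ with $\mathcal{W}_g g\in L^2(G)$; such a $g$ is called a square integrable vector. By the Duflo-Moore theorem there is a unique positive, densely defined, injective operator $C_\pi$ on $\mathcal{H}_\pi$, whose domain consists of $0$ and the square integrable vectors, with $\langle\mathcal{W}_{g_1}f_1,\mathcal{W}_{g_2}f_2\rangle_{L^2(G)}=\langle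 f_1,f_2\rangle\,\overline{\langle C_\pi g_1,C_\pi g_2\rangle}$ for all $f_1,f_2\in\mathcal{H}_\pi$ and $g_1,g_2\in\mathrm{dom}(C_\pi)$. A square integrable vector $g$ is admissible if $\|C_\pi g\|=1$; equivalently, $\mathcal{W}_g:\mathcal{H}_\pi\to L^2(G)$ is an isometry. When $G$ is unimodular, $C_\pi=c_\pi\cdot Id_{\mathcal{H}_\pi}$ for some $c_\pi>0$, so $g$ is admissible if and only if $\|g\|=c_\pi^{-1}$.
   Formalization: The conclusion t ∈ {0,1} is stated only when g_1 is not of the form c·g_2 with c ∈ 𝕋, since for g = g_1 = g_2 every t ∈ [0,1] satisfies the hypothesis; the other conclusion (g = c g_1 or g = c g_2) is unconditional. *)

theory Defs
  imports "HOL-Analysis.Analysis"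
begin

text \<open>
  Groups are written additively, following the library class \<open>topological_group_add\<close>, which does
  not require commutativity: the product \<open>x y\<close> is \<open>x + y\<close> and the identity is \<open>0\<close>.
\<close>

section \<open>Complex Hilbert spaces\<close>

text \<open>
  The complex inner product is linear in its first argument. Its real part is the inner product
  of the underlying real Hilbert space, so the norm is the one induced by \<open>cinner\<close>.
\<close>

class chilbert_space = real_inner + complete_space +
  fixes scaleC :: "complex \<Rightarrow> 'a \<Rightarrow> 'a" (infixr "*\<^sub>C" 75)
    and cinner :: "'a \<Rightarrow> 'a \<Rightarrow> complex"
  assumes scaleC_add_right: "a *\<^sub>C (x + y) = a *\<^sub>C x + a *\<^sub>C y"
    and scaleC_add_left: "(a + b) *\<^sub>C x = a *\<^sub>C x + b *\<^sub>C x"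
    and scaleC_scaleC: "a *\<^sub>C b *\<^sub>C x = (a * b) *\<^sub>C x"
    and scaleC_of_real: "complex_of_real r *\<^sub>C x = r *\<^sub>R x"
    and cinner_commute: "cinner x y = cnj (cinner y x)"
    and cinner_add_left: "cinner (x + y) z = cinner x z + cinner y z"
    and cinner_scaleC_left: "cinner (a *\<^sub>C x) y = a * cinner x y"
    and Re_cinner: "Re (cinner x y) = inner x y"

instantiation complex :: chilbert_space
begin

definition "scaleC_complex = ((*) :: complex \<Rightarrow> complex \<Rightarrow> complex)"
definition "cinner_complex = (\<lambda>x y :: complex. x * cnj y)"

instance
  by standard
    (simp_all add: scaleC_complex_def cinner_complex_def inner_complex_def algebra_simps
      scaleR_conv_of_real)

end

definition csubspace :: "'h::chilbert_space set \<Rightarrow> bool" where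
  "csubspace S \<longleftrightarrow>
     0 \<in> S \<and> (\<forall>x\<in>S. \<forall>y\<in>S. x + y \<in> S) \<and> (\<forall>c. \<forall>x\<in>S. c *\<^sub>C x \<in> S)"

definition unitary_operator :: "('h::chilbert_space \<Rightarrow> 'h) \<Rightarrow> bool" where
  "unitary_operator U \<longleftrightarrow>
     (\<forall>x y. U (x + y) = U x + U y) \<and> (\<forall>c x. U (c *\<^sub>C x) = c *\<^sub>C U x) \<and>
     (\<forall>x y. cinner (U x) (U y) = cinner x y) \<and> surj U"

section \<open>Haar measure\<close>

text \<open>
  A left Haar measure is a nonzero left-invariant Radon measure on the Borel sets: finite on
  compact sets, outer regular on Borel sets and inner regular on open sets. No countability of
  the group is assumed, so the measure need not be \<open>\<sigma>\<close>-finite.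
\<close>

definition left_haar_measure :: "'g::{topological_group_add,t2_space} measure \<Rightarrow> bool" where
  "left_haar_measure \<mu> \<longleftrightarrow>
     sets \<mu> = sets borel \<and>
     emeasure \<mu> UNIV \<noteq> 0 \<and>
     (\<forall>a. distr \<mu> borel (\<lambda>x. a + x) = \<mu>) \<and>
     (\<forall>K. compact K \<longrightarrow> emeasure \<mu> K < \<infinity>) \<and>
     (\<forall>A \<in> sets borel. emeasure \<mu> A = (INF U \<in> {U. open U \<and> A \<subseteq> U}. emeasure \<mu> U)) \<and>
     (\<forall>U. open U \<longrightarrow> emeasure \<mu> U = (SUP K \<in> {K. compact K \<and> K \<subseteq> U}. emeasure \<mu> K))"

text \<open>
  Left Haar measures being unique up to a positive factor, for a left Haar measure \<open>\<mu>\<close> this is a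
  property of the group only.
\<close>

definition unimodular :: "'g::{topological_group_add,t2_space} measure \<Rightarrow> bool" where
  "unimodular \<mu> \<longleftrightarrow> (\<forall>a. distr \<mu> borel (\<lambda>x. x + a) = \<mu>)"

definition in_L2 :: "'g measure \<Rightarrow> ('g \<Rightarrow> complex) \<Rightarrow> bool" where
  "in_L2 \<mu> F \<longleftrightarrow> F \<in> borel_measurable \<mu> \<and> integrable \<mu> (\<lambda>x. (cmod (F x))\<^sup>2)"

definition L2_inner :: "'g measure \<Rightarrow> ('g \<Rightarrow> complex) \<Rightarrow> ('g \<Rightarrow> complex) \<Rightarrow> complex" where
  "L2_inner \<mu> F H = (LINT x|\<mu>. F x * cnj (H x))"

section \<open>Square integrable representations\<close>

definition wavelet :: "('g \<Rightarrow> 'h \<Rightarrow> 'h::chilbert_space) \<Rightarrow> 'h \<Rightarrow> 'h \<Rightarrow> 'g \<Rightarrow> complex" where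
  "wavelet \<pi> g f x = cinner f (\<pi> x g)"

definition unitary_rep ::
    "('g::{topological_group_add,t2_space} \<Rightarrow> 'h \<Rightarrow> 'h::chilbert_space) \<Rightarrow> bool" where
  "unitary_rep \<pi> \<longleftrightarrow>
     (\<forall>x. unitary_operator (\<pi> x)) \<and> (\<forall>x y. \<pi> (x + y) = \<pi> x \<circ> \<pi> y) \<and>
     (\<forall>f g. continuous_on UNIV (wavelet \<pi> g f))"

definition irreducible_rep :: "('g \<Rightarrow> 'h \<Rightarrow> 'h::chilbert_space) \<Rightarrow> bool" where
  "irreducible_rep \<pi> \<longleftrightarrow>
     (\<forall>S. closed S \<and> csubspace S \<and> (\<forall>x. \<pi> x ` S \<subseteq> S) \<longrightarrow> S = {0} \<or> S = UNIV)"

definition square_integrable_vector ::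
    "'g measure \<Rightarrow> ('g \<Rightarrow> 'h \<Rightarrow> 'h::chilbert_space) \<Rightarrow> 'h \<Rightarrow> bool" where
  "square_integrable_vector \<mu> \<pi> g \<longleftrightarrow> g \<noteq> 0 \<and> in_L2 \<mu> (wavelet \<pi> g g)"

definition square_integrable_rep ::
    "'g measure \<Rightarrow> ('g::{topological_group_add,t2_space} \<Rightarrow> 'h \<Rightarrow> 'h::chilbert_space) \<Rightarrow> bool" where
  "square_integrable_rep \<mu> \<pi> \<longleftrightarrow>
     unitary_rep \<pi> \<and> irreducible_rep \<pi> \<and> (\<exists>g. square_integrable_vector \<mu> \<pi> g)"

section \<open>The Duflo--Moore operator and admissible vectors\<close>

text \<open>
  An unbounded operator with domain \<open>D\<close> is encoded as a total function that vanishes outside \<open>D\<close>.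
\<close>

definition positive_operator_on :: "'h::chilbert_space set \<Rightarrow> ('h \<Rightarrow> 'h) \<Rightarrow> bool" where
  "positive_operator_on D C \<longleftrightarrow>
     csubspace D \<and> closure D = UNIV \<and> (\<forall>f. f \<notin> D \<longrightarrow> C f = 0) \<and>
     (\<forall>f\<in>D. \<forall>g\<in>D. C (f + g) = C f + C g) \<and> (\<forall>c. \<forall>f\<in>D. C (c *\<^sub>C f) = c *\<^sub>C C f) \<and>
     (\<forall>f\<in>D. \<forall>g\<in>D. cinner (C f) g = cinner f (C g)) \<and>
     \<comment> \<open>every vector in the domain of the adjoint lies in \<open>D\<close>: with symmetry, \<open>C\<close> is self-adjoint\<close>
     (\<forall>g h. (\<forall>f\<in>D. cinner (C f) g = cinner f h) \<longrightarrow> g \<in> D) \<and>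
     (\<forall>f\<in>D. Im (cinner (C f) f) = 0 \<and> Re (cinner (C f) f) \<ge> 0)"

definition duflo_moore_domain ::
    "'g measure \<Rightarrow> ('g \<Rightarrow> 'h \<Rightarrow> 'h::chilbert_space) \<Rightarrow> 'h set" where
  "duflo_moore_domain \<mu> \<pi> = insert 0 {g. square_integrable_vector \<mu> \<pi> g}"

text \<open>
  Membership in \<open>L\<^sup>2\<close> is stated explicitly because the Bochner integral of a non-integrable
  function is \<open>0\<close>.
\<close>

definition is_duflo_moore ::
    "'g measure \<Rightarrow> ('g \<Rightarrow> 'h \<Rightarrow> 'h::chilbert_space) \<Rightarrow> ('h \<Rightarrow> 'h) \<Rightarrow> bool" where
  "is_duflo_moore \<mu> \<pi> C \<longleftrightarrow>
     (let D = duflo_moore_domain \<mu> \<pi> in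
       positive_operator_on D C \<and> inj_on C D \<and>
       (\<forall>f. \<forall>g\<in>D. in_L2 \<mu> (wavelet \<pi> g f)) \<and>
       (\<forall>f1 f2. \<forall>g1\<in>D. \<forall>g2\<in>D.
          L2_inner \<mu> (wavelet \<pi> g1 f1) (wavelet \<pi> g2 f2)
            = cinner f1 f2 * cnj (cinner (C g1) (C g2))))"

definition duflo_moore ::
    "'g measure \<Rightarrow> ('g \<Rightarrow> 'h \<Rightarrow> 'h::chilbert_space) \<Rightarrow> 'h \<Rightarrow> 'h" where
  "duflo_moore \<mu> \<pi> = (THE C. is_duflo_moore \<mu> \<pi> C)"

definition admissible ::
    "'g measure \<Rightarrow> ('g \<Rightarrow> 'h \<Rightarrow> 'h::chilbert_space) \<Rightarrow> 'h \<Rightarrow> bool" where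
  "admissible \<mu> \<pi> g \<longleftrightarrow> square_integrable_vector \<mu> \<pi> g \<and> norm (duflo_moore \<mu> \<pi> g) = 1"

end

theory Submission
  imports Defs
begin

text \<open>
  On a unimodular group the Duflo--Moore operator is a scalar \<open>sqrt d\<close>, so all admissible vectors
  have the same norm \<open>\<rho> = 1 / sqrt d\<close> and the orthogonality relations read
  \<open>\<langle>W\<^sub>u u, W\<^sub>g g\<rangle> = d \<bar>\<langle>g, u\<rangle>\<bar>\<^sup>2\<close>. Pairing the convex combination with \<open>W\<^sub>g g\<close> in \<open>L\<^sup>2\<close>
  therefore gives
  \<open>\<rho>^4 = t \<bar>\<langle>g, g1\<rangle>\<bar>^2 + (1 - t) \<bar>\<langle>g, g2\<rangle>\<bar>^2\<close>,
  where by Cauchy--Schwarz both squares are at most \<open>\<rho>^4\<close>. Equality has to hold for every summand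
  with a nonzero weight, and then \<open>g\<close> is a unimodular multiple of that vector. When
  \<open>0 < t < 1\<close> this applies to both \<open>g1\<close> and \<open>g2\<close>, which are then multiples of each other.

  The bulk of the work is to show that \<open>duflo_moore\<close>, a definite description, denotes this scalar
  (\<open>unimodular_orthogonality_relations\<close> and \<open>unimodular_duflo_moore\<close>). By left invariance,
  \<open>f \<mapsto> W\<^sub>g f\<close> turns the representation into left translation of functions; by right
  invariance, \<open>g \<mapsto> W\<^sub>g f\<close> turns it into right translation. Each is an equivariant map,
  defined on those vectors that it sends into \<open>L\<^sup>2\<close>, and its quadratic form
  \<open>u \<mapsto> \<parallel>V u\<parallel>\<^sup>2\<close> is invariant and, by Fatou's lemma, closed. For an irreducible representation, an
  invariant closed form that is finite at one nonzero vector is a multiple of \<open>\<parallel>u\<parallel>\<^sup>2\<close> on the whole space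
  (\<open>invariant_closed_form_scalar\<close>): its resolvent \<open>(1 + A)^(-1)\<close>, where \<open>A\<close> is the self-adjoint
  operator of the form, is a bounded self-adjoint intertwiner, hence a scalar by Schur's lemma.
  Applying this to both maps gives \<open>\<parallel>W\<^sub>g f\<parallel>\<^sup>2 = d \<parallel>f\<parallel>\<^sup>2 \<parallel>g\<parallel>\<^sup>2\<close>, and polarization gives the orthogonality relations.

  Schur's lemma for self-adjoint operators is derived from the absolute value \<open>S\<close> of an operator
  \<open>T\<close>, for which \<open>(S + T) (S - T) = 0\<close>.
\<close>

section \<open>Complex Hilbert spaces\<close>

instance chilbert_space \<subseteq> banach ..

lemma scaleC_zero_left [simp]: "0 *\<^sub>C x = (0::'h::chilbert_space)"
  using scaleC_of_real[of 0 x] by simp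

lemma scaleC_one [simp]: "1 *\<^sub>C x = (x::'h::chilbert_space)"
  using scaleC_of_real[of 1 x] by simp

lemma scaleC_zero_right [simp]: "a *\<^sub>C 0 = (0::'h::chilbert_space)"
  using scaleC_add_right[of a 0 "0::'h"] by simp

lemma scaleC_scaleR: "a *\<^sub>C (r *\<^sub>R x) = r *\<^sub>R (a *\<^sub>C (x::'h::chilbert_space))"
  by (simp flip: scaleC_of_real add: scaleC_scaleC mult.commute)

lemma cinner_add_right: "cinner z (x + y) = cinner z x + cinner z (y::'h::chilbert_space)"
  by (metis cinner_add_left cinner_commute complex_cnj_add)

lemma cinner_scaleC_right: "cinner x (a *\<^sub>C y) = cnj a * cinner x (y::'h::chilbert_space)"
  by (metis cinner_commute cinner_scaleC_left complex_cnj_mult)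

lemma cinner_scaleR_left: "cinner (r *\<^sub>R x) y = r *\<^sub>R cinner x (y::'h::chilbert_space)"
  using cinner_scaleC_left[of "of_real r" x y] by (simp add: scaleC_of_real scaleR_conv_of_real)

lemma cinner_scaleR_right: "cinner x (r *\<^sub>R y) = r *\<^sub>R cinner x (y::'h::chilbert_space)"
  using cinner_scaleC_right[of x "of_real r" y] by (simp add: scaleC_of_real scaleR_conv_of_real)

lemma cinner_self: "cinner x x = complex_of_real ((norm (x::'h::chilbert_space))\<^sup>2)"
proof (rule complex_eqI)
  show "Re (cinner x x) = Re (complex_of_real ((norm x)\<^sup>2))"
    by (simp add: Re_cinner power2_norm_eq_inner)
  show "Im (cinner x x) = Im (complex_of_real ((norm x)\<^sup>2))"
    using cinner_commute[of x x] by (simp add: complex_eq_iff)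
qed

lemma norm_scaleC: "norm (a *\<^sub>C x) = cmod a * norm (x::'h::chilbert_space)"
proof -
  have "complex_of_real ((norm (a *\<^sub>C x))\<^sup>2) = (a * cnj a) * cinner x x"
    by (simp only: cinner_self[symmetric] cinner_scaleC_left cinner_scaleC_right mult_ac)
  also have "\<dots> = complex_of_real ((cmod a * norm x)\<^sup>2)"
    by (simp add: cinner_self power_mult_distrib flip: complex_norm_square)
  finally have "complex_of_real ((norm (a *\<^sub>C x))\<^sup>2) = complex_of_real ((cmod a * norm x)\<^sup>2)" .
  then show ?thesis
    by (metis mult_nonneg_nonneg norm_ge_zero of_real_eq_iff power2_eq_imp_eq)
qed

lemma inner_scaleC_left: "inner (a *\<^sub>C x) y = inner x (cnj a *\<^sub>C (y::'h::chilbert_space))"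
  by (simp flip: Re_cinner add: cinner_scaleC_left cinner_scaleC_right)

lemma bounded_linear_scaleC: "bounded_linear (\<lambda>x. a *\<^sub>C (x::'h::chilbert_space))"
  by (rule bounded_linear_intro[of _ "cmod a"])
    (simp_all add: scaleC_add_right scaleC_scaleR norm_scaleC mult.commute)

lemma norm_cinner_bound: "cmod (cinner x y) \<le> norm x * norm (y::'h::chilbert_space)"
proof -
  define a where "a = cnj (sgn (cinner x y))"
  have "cmod (cinner x y) = Re (cinner (a *\<^sub>C x) y)"
    by (cases "cinner x y = 0")
      (simp_all only: cinner_scaleC_left a_def sgn_eq complex_cnj_divide complex_cnj_complex_of_real
        times_divide_eq_left mult.commute[of "cnj _"] complex_norm_square[symmetric],
        simp_all add: power2_eq_square)
  also have "\<dots> = inner (a *\<^sub>C x) y" by (rule Re_cinner)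
  also have "\<dots> \<le> norm (a *\<^sub>C x) * norm y" by (rule norm_cauchy_schwarz)
  also have "\<dots> = cmod a * (norm x * norm y)" by (simp add: norm_scaleC)
  also have "\<dots> \<le> 1 * (norm x * norm y)"
    by (rule mult_right_mono) (simp_all add: a_def norm_sgn)
  finally show ?thesis by simp
qed

lemma bounded_linear_cinner_left: "bounded_linear (\<lambda>x. cinner x (y::'h::chilbert_space))"
  by (rule bounded_linear_intro[of _ "norm y"])
    (simp_all add: cinner_add_left cinner_scaleR_left norm_cinner_bound)

lemma bounded_linear_cinner_right: "bounded_linear (\<lambda>y. cinner (x::'h::chilbert_space) y)"
  by (rule bounded_linear_intro[of _ "norm x"])
    (simp_all add: cinner_add_right cinner_scaleR_right norm_cinner_bound[of x, unfolded mult.commute[of "norm x"]])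

text \<open>
  The multiple has to be the orthogonal projection of \<open>x\<close> to the line through \<open>y\<close>, and equality in
  Cauchy--Schwarz makes the remainder \<open>x - c y\<close> vanish.
\<close>

lemma parallel_of_equality_in_Cauchy_Schwarz:
  fixes x y :: "'h::chilbert_space"
  assumes "norm x = norm y" and eq: "cmod (cinner x y) = norm x * norm y"
  shows "\<exists>c. cmod c = 1 \<and> x = c *\<^sub>C y"
proof (cases "y = 0")
  case True
  then show ?thesis using assms by (intro exI[of _ 1]) simp
next
  case False
  define c where "c = cinner x y / complex_of_real ((norm y)\<^sup>2)"
  have n: "norm y > 0" using False by simp
  have c1: "cmod c = 1"
    using n assms by (simp add: c_def norm_divide norm_mult power2_eq_square)
  have "inner x (c *\<^sub>C y) = Re (cnj c * cinner x y)"
    by (simp flip: Re_cinner add: cinner_scaleC_right)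
  also have "cinner x y = complex_of_real ((norm y)\<^sup>2) * c"
    using n by (simp add: c_def)
  also have "cnj c * \<dots> = complex_of_real ((norm y)\<^sup>2) * (c * cnj c)" by simp
  also have "c * cnj c = 1" using c1 by (simp flip: complex_norm_square)
  finally have i: "inner x (c *\<^sub>C y) = (norm y)\<^sup>2" by simp
  have "(norm (x - c *\<^sub>C y))\<^sup>2 = (norm x)\<^sup>2 - 2 * inner x (c *\<^sub>C y) + (norm (c *\<^sub>C y))\<^sup>2"
    by (simp add: power2_norm_eq_inner inner_diff_left inner_diff_right inner_commute)
  also have "\<dots> = 0" using i c1 assms by (simp add: norm_scaleC)
  finally show ?thesis using c1 by auto
qed

text \<open>
  Polarization in the form used below: applied to the difference of two sesquilinear forms, it
  reduces their equality to the diagonal.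
\<close>

lemma sesquilinear_zero_of_zero_diagonal:
  fixes B :: "'h::chilbert_space \<Rightarrow> 'h \<Rightarrow> complex"
  assumes al: "\<And>x y z. B (x + y) z = B x z + B y z"
    and ar: "\<And>x y z. B x (y + z) = B x y + B x z"
    and sl: "\<And>a x y. B (a *\<^sub>C x) y = a * B x y"
    and sr: "\<And>a x y. B x (a *\<^sub>C y) = cnj a * B x y"
    and diag: "\<And>x. B x x = 0"
  shows "B x y = 0"
proof -
  have "B x y + B y x = 0" using diag[of "x + y"] diag[of x] diag[of y] by (simp add: al ar add.commute)
  moreover have "- (\<i> * B x y) + \<i> * B y x = 0"
    using diag[of "x + \<i> *\<^sub>C y"] diag[of x] diag[of y] by (simp add: al ar sl sr)
  then have "\<i> * (B y x - B x y) = 0" by (simp add: algebra_simps)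
  then have "B y x = B x y" by simp
  ultimately show ?thesis by simp
qed

section \<open>Absolute values of self-adjoint contractions\<close>

lemma blinfun_commute_apply:
  assumes "A o\<^sub>L B = B o\<^sub>L A"
  shows "blinfun_apply A (blinfun_apply B x) = blinfun_apply B (blinfun_apply A x)"
  using arg_cong[OF assms, of "\<lambda>W. blinfun_apply W x"] by simp

text \<open>
  The solution is \<open>Y = 1 - sqrt (1 - Z)\<close>, obtained by iterating \<open>Y \<mapsto> (Z + Y\<^sup>2) / 2\<close> from \<open>0\<close>. The
  same iteration for real numbers with \<open>Z = 1\<close> increases and is bounded by \<open>1\<close>. All iterates
  commute, so consecutive differences factor as differences of squares, and induction bounds their
  norms by the differences of the real sequence. This makes the iteration norm-convergent, even in
  the boundary case \<open>norm Z = 1\<close>.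
\<close>

lemma quadratic_operator_equation:
  fixes Z :: "'a::banach \<Rightarrow>\<^sub>L 'a"
  assumes Z: "norm Z \<le> 1"
  shows "\<exists>Y. norm Y \<le> 1 \<and> 2 *\<^sub>R Y = Z + (Y o\<^sub>L Y) \<and>
    (\<forall>W. W o\<^sub>L Z = Z o\<^sub>L W \<longrightarrow> W o\<^sub>L Y = Y o\<^sub>L W)"
proof -
  define Y where "Y = rec_nat (0 :: 'a \<Rightarrow>\<^sub>L 'a) (\<lambda>_ W. (1/2) *\<^sub>R (Z + (W o\<^sub>L W)))"
  have Y0: "Y 0 = 0" and YS: "Y (Suc n) = (1/2) *\<^sub>R (Z + (Y n o\<^sub>L Y n))" for n
    by (simp_all add: Y_def)
  define y where "y = rec_nat (0 :: real) (\<lambda>_ w. (1/2) * (1 + w * w))"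
  have y0: "y 0 = 0" and yS: "y (Suc n) = (1/2) * (1 + y n * y n)" for n
    by (simp_all add: y_def)
  note bil = blinfun.bilinear_simps blinfun_apply_blinfun_compose
  (* the scalar majorant of the operator iteration *)
  have y_nonneg: "0 \<le> y n" for n by (induction n) (simp_all add: y0 yS)
  have y_le1: "y n \<le> 1" for n
  proof (induction n)
    case (Suc n)
    have "y n * y n \<le> 1 * 1" by (rule mult_mono) (use Suc y_nonneg in auto)
    then show ?case by (simp add: yS)
  qed (simp add: y0)
  have Ynorm: "norm (Y n) \<le> y n" for n
  proof (induction n)
    case (Suc n)
    have "norm (Z + (Y n o\<^sub>L Y n)) \<le> norm Z + norm (Y n) * norm (Y n)"
      using norm_triangle_ineq[of Z "Y n o\<^sub>L Y n"] norm_blinfun_compose[of "Y n" "Y n"] by linarith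
    also have "\<dots> \<le> 1 + y n * y n"
      using Z Suc by (intro add_mono mult_mono) (use y_nonneg in auto)
    finally show ?case by (simp add: YS yS)
  qed (simp add: Y0 y0)
  have comm: "W o\<^sub>L Y n = Y n o\<^sub>L W" if W: "W o\<^sub>L Z = Z o\<^sub>L W" for W n
  proof (induction n)
    case (Suc n)
    have w: "W (Z x) = Z (W x)" "W (Y n x) = Y n (W x)" for x
      by (rule blinfun_commute_apply[OF W], rule blinfun_commute_apply[OF Suc])
    show ?case by (rule blinfun_eqI) (simp add: YS bil w)
  qed (simp add: Y0 blinfun_eqI bil)
  have ZY: "Z o\<^sub>L Y n = Y n o\<^sub>L Z" for n by (rule comm) simp
  have YY: "Y m o\<^sub>L Y n = Y n o\<^sub>L Y m" for m n by (rule comm) (simp add: ZY)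
  have step: "norm (Y (Suc n) - Y n) \<le> y (Suc n) - y n" for n
  proof (induction n)
    case 0
    show ?case using Z by (simp add: YS yS Y0 y0)
  next
    case (Suc n)
    have c: "Y (Suc n) (Y n x) = Y n (Y (Suc n) x)" for x
      by (rule blinfun_commute_apply[OF YY])
    \<comment> \<open>difference of two squares of commuting operators\<close>
    have "Y (Suc (Suc n)) - Y (Suc n)
        = (1/2) *\<^sub>R ((Y (Suc n) + Y n) o\<^sub>L (Y (Suc n) - Y n))"
    proof (rule blinfun_eqI)
      fix x
      have e: "Y (Suc m) x = (1/2) *\<^sub>R (Z x + Y m (Y m x))" for m
        by (simp add: YS bil)
      have "Y (Suc (Suc n)) x - Y (Suc n) x
          = (1/2) *\<^sub>R (Z x + Y (Suc n) (Y (Suc n) x)) - (1/2) *\<^sub>R (Z x + Y n (Y n x))"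
        by (rule arg_cong2[where f=minus, OF e e])
      then show "(Y (Suc (Suc n)) - Y (Suc n)) x
          = ((1/2) *\<^sub>R ((Y (Suc n) + Y n) o\<^sub>L (Y (Suc n) - Y n))) x"
        by (simp add: bil c scaleR_add_right scaleR_diff_right)
    qed
    then have "norm (Y (Suc (Suc n)) - Y (Suc n))
        \<le> (1/2) * (norm (Y (Suc n) + Y n) * norm (Y (Suc n) - Y n))"
      using norm_blinfun_compose[of "Y (Suc n) + Y n" "Y (Suc n) - Y n"] by simp
    also have "\<dots> \<le> (1/2) * ((y (Suc n) + y n) * (y (Suc n) - y n))"
    proof (rule mult_left_mono[OF mult_mono[OF _ Suc]])
      show "norm (Y (Suc n) + Y n) \<le> y (Suc n) + y n"
        by (rule norm_triangle_le[OF add_mono[OF Ynorm Ynorm]])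
    qed (simp_all add: y_nonneg)
    also have "\<dots> = y (Suc (Suc n)) - y (Suc n)"
      using yS[of "Suc n"] yS[of n] by (simp add: algebra_simps)
    finally show ?case .
  qed
  have y_inc: "y n \<le> y (Suc n)" for n
    using order_trans[OF norm_ge_zero step[of n]] by simp
  have "convergent y"
  proof (rule Bseq_monoseq_convergent)
    show "Bseq y" by (rule BseqI'[of _ 1]) (simp add: y_le1 y_nonneg)
  qed (simp add: monoseq_Suc y_inc)
  then have "summable (\<lambda>n. y (Suc n) - y n)"
    by (auto simp: convergent_def intro: telescope_summable)
  then have "summable (\<lambda>n. Y (Suc n) - Y n)"
    by (rule summable_comparison_test[rotated]) (intro exI[of _ 0] allI impI step)
  then obtain L where "(\<lambda>n. \<Sum>i<n. Y (Suc i) - Y i) \<longlonglongrightarrow> L"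
    by (auto simp: summable_def sums_def)
  moreover have "(\<Sum>i<n. Y (Suc i) - Y i) = Y n" for n by (simp add: sum_lessThan_telescope Y0)
  ultimately have L: "Y \<longlonglongrightarrow> L" by simp
  show ?thesis
  proof (intro exI[of _ L] conjI allI impI)
    show "norm L \<le> 1"
      by (rule LIMSEQ_le_const2[OF tendsto_norm[OF L]])
        (intro exI[of _ 0] allI impI order_trans[OF Ynorm y_le1])
    have "(\<lambda>n. Y (Suc n)) \<longlonglongrightarrow> (1/2) *\<^sub>R (Z + (L o\<^sub>L L))"
      unfolding YS
      by (intro tendsto_intros L bounded_bilinear.tendsto[OF bounded_bilinear_blinfun_compose])
    then have "L = (1/2) *\<^sub>R (Z + (L o\<^sub>L L))"
      by (rule LIMSEQ_unique[OF LIMSEQ_Suc[OF L]])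
    then have "2 *\<^sub>R L = 2 *\<^sub>R (1/2) *\<^sub>R (Z + (L o\<^sub>L L))" by (rule arg_cong)
    then show "2 *\<^sub>R L = Z + (L o\<^sub>L L)" by simp
    fix W assume W: "W o\<^sub>L Z = Z o\<^sub>L W"
    note tendsto_compose = bounded_bilinear.tendsto[OF bounded_bilinear_blinfun_compose]
    have "(\<lambda>n. W o\<^sub>L Y n) \<longlonglongrightarrow> (L o\<^sub>L W)"
      unfolding comm[OF W] by (rule tendsto_compose[OF L tendsto_const])
    then show "W o\<^sub>L L = L o\<^sub>L W"
      by (rule LIMSEQ_unique[OF tendsto_compose[OF tendsto_const L]])
  qed
qed

text \<open>
  The operator \<open>S\<close> is \<open>sqrt (T\<^sup>2)\<close>. Take \<open>Z = 1 - T\<^sup>2\<close>, a contraction because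
  \<open>\<parallel>x - T\<^sup>2 x\<parallel>\<^sup>2 = \<parallel>x\<parallel>\<^sup>2 - 2 \<parallel>T x\<parallel>\<^sup>2 + \<parallel>T\<^sup>2 x\<parallel>\<^sup>2\<close>. Then the equation \<open>2 Y = Z + Y\<^sup>2\<close> says that
  \<open>(1 - Y)\<^sup>2 = T\<^sup>2\<close>. Positivity of \<open>S = 1 - Y\<close> is immediate from \<open>norm Y \<le> 1\<close>.
\<close>

lemma absolute_value_of_contraction:
  fixes T :: "'a::{real_inner,banach} \<Rightarrow>\<^sub>L 'a"
  assumes T: "norm T \<le> 1" and sa: "\<And>x y. inner (T x) y = inner x (T y)"
  shows "\<exists>S. S o\<^sub>L S = T o\<^sub>L T \<and> (\<forall>x. 0 \<le> inner (S x) x) \<and>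
    (\<forall>W. W o\<^sub>L T = T o\<^sub>L W \<longrightarrow> W o\<^sub>L S = S o\<^sub>L W)"
proof -
  note bil = blinfun.bilinear_simps blinfun_apply_blinfun_compose
  define Z where "Z = id_blinfun - (T o\<^sub>L T)"
  have contr: "norm (T x) \<le> norm x" for x
    using norm_blinfun[of T x] T mult_right_mono[of "norm T" 1 "norm x"] by simp
  have "norm (Z x) \<le> norm x" for x
  proof -
    have "(norm (Z x))\<^sup>2 = (norm x)\<^sup>2 - 2 * (norm (T x))\<^sup>2 + (norm (T (T x)))\<^sup>2"
      by (simp add: Z_def bil power2_norm_eq_inner inner_diff_left inner_diff_right sa[of "T x" x]
          inner_commute[of x "T (T x)"])
    also have "\<dots> \<le> (norm x)\<^sup>2"
      using power_mono[OF contr[of "T x"] norm_ge_zero, of 2] zero_le_power2[of "norm (T x)"]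
      by linarith
    finally show ?thesis by (rule power2_le_imp_le) simp
  qed
  then have "norm Z \<le> 1" by (intro norm_blinfun_bound) simp_all
  then obtain Y where Y: "norm Y \<le> 1" "2 *\<^sub>R Y = Z + (Y o\<^sub>L Y)"
    and com: "\<And>W. W o\<^sub>L Z = Z o\<^sub>L W \<Longrightarrow> W o\<^sub>L Y = Y o\<^sub>L W"
    using quadratic_operator_equation by blast
  show ?thesis
  proof (intro exI[of _ "id_blinfun - Y"] conjI allI impI)
    have y: "2 *\<^sub>R Y x = x - T (T x) + Y (Y x)" for x
      using arg_cong[OF Y(2), of "\<lambda>W. blinfun_apply W x"] by (simp add: bil Z_def)
    show "(id_blinfun - Y) o\<^sub>L (id_blinfun - Y) = T o\<^sub>L T"
    proof (rule blinfun_eqI)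
      fix x
      show "((id_blinfun - Y) o\<^sub>L (id_blinfun - Y)) x = (T o\<^sub>L T) x"
      proof -
        have "T (T x) = x + Y (Y x) - 2 *\<^sub>R Y x" by (simp only: y) simp
        then show ?thesis by (simp add: bil scaleR_2)
      qed
    qed
    fix x
    have Yx: "norm (Y x) \<le> norm x"
      using norm_blinfun[of Y x] Y(1) mult_right_mono[of "norm Y" 1 "norm x"] by simp
    have "inner (Y x) x \<le> norm (Y x) * norm x" by (rule norm_cauchy_schwarz)
    also have "\<dots> \<le> norm x * norm x" by (rule mult_right_mono[OF Yx]) simp
    also have "\<dots> = inner x x" by (simp add: dot_square_norm power2_eq_square)
    finally show "0 \<le> inner ((id_blinfun - Y) x) x" by (simp add: bil inner_diff_left)
  next
    fix W assume W: "W o\<^sub>L T = T o\<^sub>L W"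
    then have w: "W (T x) = T (W x)" for x by (rule blinfun_commute_apply)
    have "W o\<^sub>L Y = Y o\<^sub>L W"
      by (rule com) (rule blinfun_eqI, simp add: Z_def bil w)
    then have "W (Y x) = Y (W x)" for x by (rule blinfun_commute_apply)
    then show "W o\<^sub>L (id_blinfun - Y) = (id_blinfun - Y) o\<^sub>L W"
      by (intro blinfun_eqI) (simp add: bil)
  qed
qed

section \<open>Unitary representations and Schur's lemma\<close>

lemma bounded_linear_unitary_operator:
  assumes "unitary_operator U"
  shows "bounded_linear U"
proof (rule bounded_linear_intro[of _ 1])
  have a: "U (x + y) = U x + U y" "U (c *\<^sub>C x) = c *\<^sub>C U x" "cinner (U x) (U y) = cinner x y"
    for x y c using assms by (auto simp: unitary_operator_def)
  show "U (x + y) = U x + U y" for x y by (rule a)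
  show "U (r *\<^sub>R x) = r *\<^sub>R U x" for r x by (simp flip: scaleC_of_real add: a)
  show "norm (U x) \<le> norm x * 1" for x
    using a(3)[of x x] by (simp add: norm_eq_sqrt_inner flip: Re_cinner)
qed

lemma unitary_rep_zero:
  assumes "unitary_rep \<pi>" shows "\<pi> 0 x = x"
proof -
  have "surj (\<pi> 0)" using assms by (auto simp: unitary_rep_def unitary_operator_def)
  then obtain y where "x = \<pi> 0 y" by blast
  moreover have "\<pi> (0 + 0) = \<pi> 0 \<circ> \<pi> 0" using assms unfolding unitary_rep_def by blast
  from this[THEN fun_cong, of y] have "\<pi> 0 (\<pi> 0 y) = \<pi> 0 y" by simp
  ultimately show ?thesis by simp
qed

lemma unitary_rep_uminus:
  assumes "unitary_rep \<pi>"
  shows "\<pi> y (\<pi> (- y) x) = x" "\<pi> (- y) (\<pi> y x) = x"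
proof -
  have "\<pi> (y + - y) = \<pi> y \<circ> \<pi> (- y)" "\<pi> (- y + y) = \<pi> (- y) \<circ> \<pi> y"
    using assms unfolding unitary_rep_def by blast+
  from this[THEN fun_cong, of x] show "\<pi> y (\<pi> (- y) x) = x" "\<pi> (- y) (\<pi> y x) = x"
    by (simp_all add: unitary_rep_zero[OF assms])
qed

lemma unitary_rep_adjoint:
  assumes "unitary_rep \<pi>"
  shows "cinner (\<pi> y u) w = cinner u (\<pi> (- y) w)"
proof -
  have "cinner (\<pi> y u) (\<pi> y (\<pi> (- y) w)) = cinner u (\<pi> (- y) w)"
    using assms unfolding unitary_rep_def unitary_operator_def by blast
  then show ?thesis by (simp add: unitary_rep_uminus[OF assms])
qed

text \<open>
  For every real \<open>l\<close> the operator \<open>R - l\<close> has a definite sign. Indeed, let \<open>T\<close> be a positive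
  multiple of it with norm at most \<open>1\<close> and \<open>S\<close> its absolute value. The kernel of \<open>S - T\<close> is a closed
  invariant subspace which contains the range of \<open>S + T\<close>. If it is everything, \<open>T = S\<close> is positive;
  if it is trivial, \<open>T = - S\<close> is negative. So no real number separates two values of the Rayleigh
  quotient \<open>\<langle>R x, x\<rangle> / \<langle>x, x\<rangle>\<close>, which is therefore constant.
\<close>

lemma Schur_self_adjoint:
  fixes \<pi> :: "'g \<Rightarrow> 'h \<Rightarrow> 'h::chilbert_space"
  assumes irr: "irreducible_rep \<pi>" and uni: "\<And>x. unitary_operator (\<pi> x)"
    and R: "bounded_linear R" and sa: "\<And>x y. inner (R x) y = inner x (R y)"
    and comm_pi: "\<And>y x. R (\<pi> y x) = \<pi> y (R x)"
    and comm_C: "\<And>a x. R (a *\<^sub>C x) = a *\<^sub>C R x"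
  obtains r where "\<And>x. R x = r *\<^sub>R x"
proof -
  note bil = blinfun.bilinear_simps blinfun_apply_blinfun_compose
  have sign: "(\<forall>x. l * inner x x \<le> inner (R x) x) \<or> (\<forall>x. inner (R x) x \<le> l * inner x x)" for l
  proof -
    define B where "B = Blinfun R - l *\<^sub>R id_blinfun"
    have B: "B x = R x - l *\<^sub>R x" for x
      by (simp add: B_def bil bounded_linear_Blinfun_apply[OF R])
    (* the 1 keeps the normalizing factor positive when B = 0 *)
    define k where "k = norm B + 1"
    have k: "k > 0" "norm B \<le> k" by (simp_all add: k_def add_nonneg_pos)
    define T where "T = (1/k) *\<^sub>R B"
    have Tx: "T x = (1/k) *\<^sub>R (R x - l *\<^sub>R x)" for x by (simp add: T_def bil B)
    have "norm T \<le> 1" using k by (simp add: T_def)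
    moreover have "inner (T x) y = inner x (T y)" for x y
      by (simp add: Tx inner_diff_left inner_diff_right sa)
    ultimately obtain S where S: "S o\<^sub>L S = T o\<^sub>L T" "\<And>x. 0 \<le> inner (S x) x"
      and com: "\<And>W. W o\<^sub>L T = T o\<^sub>L W \<Longrightarrow> W o\<^sub>L S = S o\<^sub>L W"
      using absolute_value_of_contraction by metis
    have com': "S (f x) = f (S x)" "T (f x) = f (T x)"
      if f: "bounded_linear f" and fR: "\<And>x. R (f x) = f (R x)" for f x
    proof -
      have T: "T (f x) = f (T x)" for x
        by (simp add: Tx fR linear_diff[OF bounded_linear.linear[OF f]]
            linear_scale[OF bounded_linear.linear[OF f]])
      then show "T (f x) = f (T x)" .
      have "Blinfun f o\<^sub>L S = S o\<^sub>L Blinfun f"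
        by (rule com) (rule blinfun_eqI, simp add: bil bounded_linear_Blinfun_apply[OF f] T)
      then show "S (f x) = f (S x)"
        using blinfun_commute_apply[of "Blinfun f" S x] by (simp add: bounded_linear_Blinfun_apply[OF f])
    qed
    have ST: "S (T x) = T (S x)" for x
      by (rule blinfun_commute_apply[symmetric]) (simp add: com)
    have SS: "S (S x) = T (T x)" for x
      using arg_cong[OF S(1), of "\<lambda>W. blinfun_apply W x"] by simp
    (* the kernel of S - T, which is twice the negative part of T *)
    define N where "N = {x. S x = T x}"
    have "closed N"
      unfolding N_def by (intro closed_Collect_eq continuous_intros)
    moreover have "csubspace N"
      by (auto simp: csubspace_def N_def bil com'[OF bounded_linear_scaleC] comm_C)
    moreover have "\<pi> y ` N \<subseteq> N" for y
      by (auto simp: N_def com'[OF bounded_linear_unitary_operator[OF uni]] comm_pi)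
    ultimately consider "N = {0}" | "N = UNIV"
      using irr by (auto simp: irreducible_rep_def)
    then show ?thesis
    proof cases
      case 1
      have "S x + T x \<in> N" for x by (simp add: N_def bil SS ST)
      then have "T x = - S x" for x using 1 by (metis add_eq_0_iff2 minus_unique singletonD add.commute)
      then have "inner (T x) x \<le> 0" for x using S(2)[of x] by simp
      then have "inner (R x) x \<le> l * inner x x" for x
        using k by (simp add: Tx inner_diff_left divide_le_0_iff)
      then show ?thesis by blast
    next
      case 2
      have "T x = S x" for x
      proof -
        have "x \<in> N" using 2 by (rule ssubst) (rule UNIV_I)
        then show ?thesis by (simp add: N_def)
      qed
      then have "0 \<le> inner (T x) x" for x using S(2)[of x] by simp
      then have "l * inner x x \<le> inner (R x) x" for x
        using k by (simp add: Tx inner_diff_left zero_le_divide_iff)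
      then show ?thesis by blast
    qed
  qed
  define \<rho> where "\<rho> x = inner (R x) x / inner x x" for x
  have le: "\<rho> x \<le> \<rho> y" if "x \<noteq> 0" "y \<noteq> 0" for x y
  proof (rule ccontr)
    assume "\<not> \<rho> x \<le> \<rho> y"
    then obtain l where l: "\<rho> y < l" "l < \<rho> x" using dense by (metis not_le)
    then have "inner (R y) y < l * inner y y" "l * inner x x < inner (R x) x"
      using that by (auto simp: \<rho>_def field_simps)
    then show False using sign[of l] by (meson not_le)
  qed
  obtain r where r: "inner (R x) x = r * inner x x" for x
  proof (cases "\<exists>z::'h. z \<noteq> 0")
    case True
    then obtain z :: 'h where z: "z \<noteq> 0" by blast
    have "inner (R x) x = \<rho> z * inner x x" for x
    proof (cases "x = 0")
      case False
      then have "\<rho> x = \<rho> z" using le z by (simp add: order_antisym)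
      then show ?thesis using False by (auto simp: \<rho>_def field_simps)
    qed simp
    then show ?thesis by (rule that)
  next
    case False
    then have "x = 0" for x :: 'h by blast
    then show ?thesis by (metis inner_zero_right mult_zero_right that)
  qed
  show thesis
  proof (rule that)
    fix x
    have add: "R (u + v) = R u + R v" for u v
      using R by (simp add: linear_add bounded_linear.linear)
    define w where "w = R x - r *\<^sub>R x"
    have "inner (R x) w = r * inner x w"
      using r[of "x + w"] r[of x] r[of w] sa[of x w]
      by (simp add: add inner_add_left inner_add_right inner_commute algebra_simps)
    then have "inner w w = 0" by (simp add: w_def inner_diff_left)
    then show "R x = r *\<^sub>R x" by (simp add: w_def)
  qed
qed

section \<open>Closed quadratic forms\<close>

lemma norm_diff_scaleR_square:
  fixes a d :: "'a::real_inner"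
  shows "(norm (a - r *\<^sub>R d))\<^sup>2 = (norm a)\<^sup>2 - 2 * r * inner a d + r\<^sup>2 * (norm d)\<^sup>2"
  unfolding power2_norm_eq_inner
  by (simp add: inner_diff_left inner_diff_right inner_commute)
    (simp add: power2_eq_square algebra_simps)

text \<open>
  Closedness is expressed as
  lower semicontinuity of \<open>u \<mapsto> b u u\<close>, extended by infinity outside \<open>D\<close>, because this is
  the form in which Fatou's lemma delivers it.
\<close>

locale closed_form =
  fixes D :: "'h::{real_inner,banach} set" and b :: "'h \<Rightarrow> 'h \<Rightarrow> real"
  assumes subspace_D: "subspace D"
    and b_add: "\<And>u v w. u \<in> D \<Longrightarrow> v \<in> D \<Longrightarrow> w \<in> D \<Longrightarrow> b (u + v) w = b u w + b v w"
    and b_scale: "\<And>r u w. u \<in> D \<Longrightarrow> w \<in> D \<Longrightarrow> b (r *\<^sub>R u) w = r * b u w"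
    and b_sym: "\<And>u w. b u w = b w u"
    and b_nonneg: "\<And>u. 0 \<le> b u u"
    and b_closed: "\<And>X l a A. (\<And>n. X n \<in> D) \<Longrightarrow> X \<longlonglongrightarrow> l \<Longrightarrow> (\<And>n. b (X n) (X n) \<le> a n) \<Longrightarrow>
      a \<longlonglongrightarrow> A \<Longrightarrow> l \<in> D \<and> b l l \<le> A"
begin

lemmas D_closure = subspace_add[OF subspace_D] subspace_scale[OF subspace_D]
  subspace_diff[OF subspace_D] subspace_0[OF subspace_D]

lemma b_add_right: "u \<in> D \<Longrightarrow> v \<in> D \<Longrightarrow> w \<in> D \<Longrightarrow> b w (u + v) = b w u + b w v"
  using b_add b_sym by metis

lemma b_scale_right: "u \<in> D \<Longrightarrow> w \<in> D \<Longrightarrow> b w (r *\<^sub>R u) = r * b w u"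
  using b_scale b_sym by metis

lemma b_diff:
  assumes "u \<in> D" "v \<in> D" "w \<in> D"
  shows "b (u - v) w = b u w - b v w"
  using b_add[OF assms(1) D_closure(2)[OF assms(2)] assms(3), of "-1"] b_scale[OF assms(2,3), of "-1"]
  by simp

lemma b_square:
  assumes "u \<in> D" "v \<in> D"
  shows "b (u + r *\<^sub>R v) (u + r *\<^sub>R v) = b u u + 2 * r * b u v + r\<^sup>2 * b v v"
  using assms
  by (simp add: b_add b_add_right b_scale b_scale_right D_closure b_sym[of v u] power2_eq_square
      algebra_simps)

text \<open>
  The equation is the Euler equation of the minimization of \<open>F u = b u u + \<parallel>f - u\<parallel>\<^sup>2\<close> over \<open>D\<close>. The
  parallelogram law makes minimizing sequences Cauchy, and lower semicontinuity puts the limit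
  into \<open>D\<close> and makes it a minimizer.
\<close>

lemma resolvent_exists: "\<exists>u\<in>D. \<forall>w\<in>D. b u w + inner u w = inner f w"
proof -
  define F where "F u = b u u + (norm (f - u))\<^sup>2" for u
  have F_line: "F (z + r *\<^sub>R d)
      = F z + 2 * r * (b z d - inner (f - z) d) + r\<^sup>2 * (b d d + (norm d)\<^sup>2)"
    if "z \<in> D" "d \<in> D" for z d r
    unfolding F_def diff_diff_eq[symmetric] norm_diff_scaleR_square b_square[OF that]
    by (simp add: algebra_simps)
  define m where "m = Inf (F ` D)"
  have F_nonneg: "0 \<le> F u" for u by (simp add: F_def b_nonneg)
  have ne: "F ` D \<noteq> {}" using D_closure(4) by blast
  have bdd: "bdd_below (F ` D)" by (rule bdd_belowI[of _ 0]) (auto simp: F_nonneg)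
  have m_le: "m \<le> F u" if "u \<in> D" for u
    unfolding m_def by (rule cInf_lower[OF _ bdd]) (use that in auto)
  have "\<exists>u\<in>D. F u < m + 1 / real (Suc n)" for n
  proof -
    have "Inf (F ` D) < m + 1 / real (Suc n)" by (simp add: m_def)
    then show ?thesis using cInf_lessD[OF ne] by (metis imageE)
  qed
  then obtain X where XD: "\<And>n. X n \<in> D" and XF: "\<And>n. F (X n) < m + 1 / real (Suc n)"
    by metis
  have parallelogram: "(norm (u - v))\<^sup>2 \<le> 2 * (F u - m) + 2 * (F v - m)" if "u \<in> D" "v \<in> D" for u v
  proof -
    define d where "d = (1/2) *\<^sub>R (u - v)"
    define z where "z = (1/2) *\<^sub>R (u + v)"
    have uv: "u = z + 1 *\<^sub>R d" "v = z + (-1) *\<^sub>R d"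
      using scaleR_half_double[of u] scaleR_half_double[of v] unfolding d_def z_def
      by (simp_all add: scaleR_add_right scaleR_diff_right)
    have zd: "z \<in> D" "d \<in> D" unfolding z_def d_def using that by (auto intro!: D_closure)
    have "F u = F z + 2 * (b z d - inner (f - z) d) + (b d d + (norm d)\<^sup>2)"
      using F_line[OF zd, of 1] uv(1) by simp
    moreover have "F v = F z - 2 * (b z d - inner (f - z) d) + (b d d + (norm d)\<^sup>2)"
      using F_line[OF zd, of "-1"] uv(2) by simp
    moreover have "norm (u - v) = 2 * norm d" by (simp add: d_def)
    ultimately show ?thesis using m_le[OF zd(1)] b_nonneg[of d] by (simp add: power_mult_distrib)
  qed
  have "Cauchy X"
  proof (rule metric_CauchyI)
    fix e :: real assume e: "0 < e"
    obtain N where N: "4 / e\<^sup>2 < real N" using reals_Archimedean2 by blast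
    have "dist (X i) (X j) < e" if ij: "i \<ge> N" "j \<ge> N" for i j
    proof -
      have N0: "0 < real N" using N e by (meson divide_pos_pos order_less_trans zero_less_numeral zero_less_power)
      have q: "F (X k) - m < 1 / real N" if "k \<ge> N" for k
      proof -
        have "F (X k) - m < 1 / real (Suc k)" using XF[of k] by simp
        also have "\<dots> \<le> 1 / real N" using that N0 by (intro divide_left_mono) auto
        finally show ?thesis .
      qed
      have "(norm (X i - X j))\<^sup>2 < 4 / real N"
        using parallelogram[OF XD XD, of i j] q[OF ij(1)] q[OF ij(2)] by simp
      also have "\<dots> < e\<^sup>2" using N N0 e by (simp add: field_simps)
      finally show ?thesis using e by (simp add: dist_norm power2_less_imp_less)
    qed
    then show "\<exists>N. \<forall>i\<ge>N. \<forall>j\<ge>N. dist (X i) (X j) < e" by blast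
  qed
  then obtain l where l: "X \<longlonglongrightarrow> l" using Cauchy_convergent convergent_def by blast
  have "(\<lambda>n. m + 1 / real (Suc n) - (norm (f - X n))\<^sup>2) \<longlonglongrightarrow> m + 0 - (norm (f - l))\<^sup>2"
    by (intro tendsto_intros l LIMSEQ_Suc[OF lim_1_over_n])
  then have "l \<in> D \<and> b l l \<le> m + 0 - (norm (f - l))\<^sup>2"
    using XF by (intro b_closed[OF XD l]) (auto simp: F_def field_simps intro: less_imp_le)
  then have lD: "l \<in> D" and Fl: "F l \<le> m" by (auto simp: F_def)
  have "b l w + inner l w = inner f w" if w: "w \<in> D" for w
  proof -
    define p where "p = b w w + (norm w)\<^sup>2"
    define q where "q = b l w - inner (f - l) w"
    have p: "0 \<le> p" by (simp add: p_def b_nonneg)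
    have quad: "0 \<le> 2 * s * q + s\<^sup>2 * p" for s
    proof -
      have "F l \<le> F (l + s *\<^sub>R w)" 
        by (rule order_trans[OF Fl m_le[OF D_closure(1)[OF lD D_closure(2)[OF w]]]])
      then show ?thesis by (simp add: F_line lD w p_def q_def algebra_simps)
    qed
    have "q = 0"
    proof (rule ccontr)
      assume "q \<noteq> 0"
      (* near the minimum of the quadratic; p + 1 instead of p avoids a division by zero *)
      define s where "s = q / (p + 1)"
      have q: "q = s * (p + 1)" using p by (simp add: s_def)
      then have "0 < s\<^sup>2 * (p + 2)" 
        using \<open>q \<noteq> 0\<close> p by (simp add: zero_less_mult_iff)
      moreover have "2 * (- s) * q + (- s)\<^sup>2 * p = - (s\<^sup>2 * (p + 2))"
        unfolding q by (simp add: power2_eq_square algebra_simps)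
      ultimately show False using quad[of "- s"] by linarith
    qed
    then show ?thesis by (simp add: q_def inner_diff_left)
  qed
  then show ?thesis using lD by blast
qed

lemma resolvent_unique:
  assumes "u \<in> D" "v \<in> D"
    and "\<And>w. w \<in> D \<Longrightarrow> b u w + inner u w = inner f w"
    and "\<And>w. w \<in> D \<Longrightarrow> b v w + inner v w = inner f w"
  shows "u = v"
proof -
  define d where "d = u - v"
  have d: "d \<in> D" unfolding d_def using assms(1,2) by (rule D_closure)
  have "b d d = b u d - b v d" using b_diff[OF assms(1,2) d] by (simp add: d_def)
  moreover have "inner d d = inner u d - inner v d" by (simp add: d_def inner_diff_left)
  ultimately have "b d d + inner d d = 0" using assms(3,4)[OF d] by linarith
  then have "d = 0" using b_nonneg[of d] inner_ge_zero[of d] by (simp add: add_nonneg_eq_0_iff)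
  then show ?thesis by (simp add: d_def)
qed

definition resolvent :: "'h \<Rightarrow> 'h" where
  "resolvent f = (SOME u. u \<in> D \<and> (\<forall>w\<in>D. b u w + inner u w = inner f w))"

lemma resolvent_D: "resolvent f \<in> D"
  and resolvent_eq: "w \<in> D \<Longrightarrow> b (resolvent f) w + inner (resolvent f) w = inner f w"
proof -
  have "resolvent f \<in> D \<and> (\<forall>w\<in>D. b (resolvent f) w + inner (resolvent f) w = inner f w)"
    unfolding resolvent_def by (rule someI_ex) (use resolvent_exists in blast)
  then show "resolvent f \<in> D" "w \<in> D \<Longrightarrow> b (resolvent f) w + inner (resolvent f) w = inner f w"
    by auto
qed

lemma resolvent_eqI:
  assumes "u \<in> D" and "\<And>w. w \<in> D \<Longrightarrow> b u w + inner u w = inner f w"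
  shows "resolvent f = u"
  by (rule resolvent_unique[OF resolvent_D assms(1) resolvent_eq assms(2)])

lemma resolvent_self_adjoint: "inner (resolvent f) g = inner f (resolvent g)"
  using resolvent_eq[OF resolvent_D, of f g] resolvent_eq[OF resolvent_D, of g f]
    b_sym[of "resolvent f"] by (simp add: inner_commute)

lemma bounded_linear_resolvent: "bounded_linear resolvent"
proof (rule bounded_linear_intro[of _ 1])
  fix f g r
  show "resolvent (f + g) = resolvent f + resolvent g"
  proof (rule resolvent_eqI)
    fix w assume w: "w \<in> D"
    show "b (resolvent f + resolvent g) w + inner (resolvent f + resolvent g) w = inner (f + g) w"
      using resolvent_eq[OF w, of f] resolvent_eq[OF w, of g]
      by (simp add: b_add resolvent_D w inner_add_left)
  qed (intro D_closure resolvent_D)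
  show "resolvent (r *\<^sub>R f) = r *\<^sub>R resolvent f"
  proof (rule resolvent_eqI)
    fix w assume w: "w \<in> D"
    show "b (r *\<^sub>R resolvent f) w + inner (r *\<^sub>R resolvent f) w = inner (r *\<^sub>R f) w"
      by (simp add: b_scale resolvent_D w flip: resolvent_eq[OF w, of f] distrib_left)
  qed (intro D_closure resolvent_D)
  show "norm (resolvent f) \<le> norm f * 1" for f
  proof (cases "resolvent f = 0")
    case False
    have "norm (resolvent f) * norm (resolvent f) \<le> inner f (resolvent f)"
      using resolvent_eq[OF resolvent_D, of f f] b_nonneg[of "resolvent f"]
      by (simp add: dot_square_norm power2_eq_square)
    also have "\<dots> \<le> norm f * norm (resolvent f)" by (rule norm_cauchy_schwarz)
    finally show ?thesis using False by simp
  qed simp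
qed

text \<open>
  The equation that determines \<open>resolvent f\<close> is carried by \<open>U\<close> to the one for \<open>U f\<close>, once \<open>U\<close> is moved
  to the test vector, where it becomes its adjoint \<open>U'\<close>.
\<close>

lemma resolvent_commutes:
  assumes U: "\<And>u. u \<in> D \<Longrightarrow> U u \<in> D" and U': "\<And>u. u \<in> D \<Longrightarrow> U' u \<in> D"
    and b: "\<And>u w. u \<in> D \<Longrightarrow> w \<in> D \<Longrightarrow> b (U u) w = b u (U' w)"
    and adj: "\<And>u w. inner (U u) w = inner u (U' w)"
  shows "resolvent (U f) = U (resolvent f)"
  by (rule resolvent_eqI) (simp_all add: U U' b adj resolvent_D resolvent_eq)

end

text \<open>
  The resolvent \<open>R\<close> of the form commutes with the representation, so \<open>R = r\<close> is a scalar. It is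
  nonzero, since \<open>R f = 0\<close> would make \<open>f\<close> orthogonal to \<open>D\<close>, which \<open>f0 \<in> D\<close> is not. As \<open>R\<close> maps
  into \<open>D\<close>, it follows that \<open>D\<close> is the whole space, and the equation for \<open>R f = r f\<close> yields
  \<open>r * b f f = (1 - r) * \<parallel>f\<parallel>\<^sup>2\<close>.
\<close>

theorem invariant_closed_form_scalar:
  fixes D :: "'h::chilbert_space set"
    and \<pi> :: "'g::{topological_group_add,t2_space} \<Rightarrow> 'h \<Rightarrow> 'h"
  assumes form: "closed_form D b"
    and rep: "unitary_rep \<pi>" and irr: "irreducible_rep \<pi>"
    and D_pi: "\<And>y u. u \<in> D \<Longrightarrow> \<pi> y u \<in> D"
    and D_scaleC: "\<And>c u. u \<in> D \<Longrightarrow> c *\<^sub>C u \<in> D"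
    and b_pi: "\<And>y u w. u \<in> D \<Longrightarrow> w \<in> D \<Longrightarrow> b (\<pi> y u) w = b u (\<pi> (- y) w)"
    and b_scaleC: "\<And>c u w. u \<in> D \<Longrightarrow> w \<in> D \<Longrightarrow> b (c *\<^sub>C u) w = b u (cnj c *\<^sub>C w)"
    and f0: "f0 \<in> D" "f0 \<noteq> 0"
  shows "D = UNIV \<and> (\<exists>k. \<forall>f. b f f = k * (norm f)\<^sup>2)"
proof -
  interpret closed_form D b by (rule form)
  obtain r where r: "\<And>x. resolvent x = r *\<^sub>R x"
  proof (rule Schur_self_adjoint[OF irr _ bounded_linear_resolvent resolvent_self_adjoint])
    show "unitary_operator (\<pi> x)" for x using rep by (simp add: unitary_rep_def)
    show "resolvent (\<pi> y x) = \<pi> y (resolvent x)" for y x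
      by (rule resolvent_commutes[where U = "\<pi> y" and U' = "\<pi> (- y)"])
        (simp_all only: D_pi b_pi unitary_rep_adjoint[OF rep] Re_cinner[symmetric])
    show "resolvent (a *\<^sub>C x) = a *\<^sub>C resolvent x" for a x
      by (rule resolvent_commutes[where U = "\<lambda>w. a *\<^sub>C w" and U' = "\<lambda>w. cnj a *\<^sub>C w"])
        (rule D_scaleC D_scaleC b_scaleC inner_scaleC_left; assumption)+
  qed (rule that)
  have r0: "r \<noteq> 0"
  proof
    assume "r = 0"
    then have "inner f0 f0 = b 0 f0"
      using resolvent_eq[OF f0(1), of f0] unfolding r by simp
    moreover have "b 0 f0 = 0" using b_scale[OF f0(1) f0(1), of 0] by simp
    ultimately show False using f0(2) by simp
  qed
  have D: "f \<in> D" for f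
    using D_closure(2)[OF resolvent_D[of f], of "1 / r"] r0 by (simp add: r)
  have "b f f = ((1 - r) / r) * (norm f)\<^sup>2" for f
  proof -
    have "r * b f f + r * inner f f = inner f f"
      using resolvent_eq[OF D, of f f] unfolding r by (simp add: b_scale D)
    then have "r * b f f = (1 - r) * (norm f)\<^sup>2" by (simp add: power2_norm_eq_inner algebra_simps)
    then show ?thesis using r0 by (simp add: field_simps)
  qed
  then show ?thesis using D by blast
qed

section \<open>Square integrable functions\<close>

lemma borel_measurable_cnj:
  "H \<in> borel_measurable M \<Longrightarrow> (\<lambda>x. cnj (H x)) \<in> borel_measurable M"
  by (rule borel_measurable_continuous_on[OF continuous_on_cnj[OF continuous_on_id], of H M])

lemma in_L2_mult:
  assumes "in_L2 \<mu> F" "in_L2 \<mu> H"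
  shows "integrable \<mu> (\<lambda>x. F x * cnj (H x))"
proof (rule Bochner_Integration.integrable_bound)
  show "integrable \<mu> (\<lambda>x. (cmod (F x))\<^sup>2 + (cmod (H x))\<^sup>2)"
    using assms by (simp add: in_L2_def)
  have [measurable]: "F \<in> borel_measurable \<mu>" "H \<in> borel_measurable \<mu>"
    using assms by (simp_all add: in_L2_def)
  show "(\<lambda>x. F x * cnj (H x)) \<in> borel_measurable \<mu>"
    by (intro borel_measurable_times borel_measurable_cnj) measurable
  have "cmod (F x * cnj (H x)) \<le> (cmod (F x))\<^sup>2 + (cmod (H x))\<^sup>2" for x
    using sum_squares_bound[of "cmod (F x)" "cmod (H x)"]
      mult_nonneg_nonneg[OF norm_ge_zero[of "F x"] norm_ge_zero[of "H x"]]
    unfolding norm_mult complex_mod_cnj by linarith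
  then show "AE x in \<mu>. norm (F x * cnj (H x)) \<le> norm ((cmod (F x))\<^sup>2 + (cmod (H x))\<^sup>2)"
    by (intro AE_I2) (simp add: abs_of_nonneg)
qed

lemma in_L2_add:
  assumes "in_L2 \<mu> F" "in_L2 \<mu> H"
  shows "in_L2 \<mu> (\<lambda>x. F x + H x)"
proof -
  have m[measurable]: "F \<in> borel_measurable \<mu>" "H \<in> borel_measurable \<mu>"
    using assms by (simp_all add: in_L2_def)
  have eq: "(cmod (F x + H x))\<^sup>2
      = (cmod (F x))\<^sup>2 + (cmod (H x))\<^sup>2 + 2 * Re (F x * cnj (H x))" for x
    unfolding cmod_power2 by (simp add: power2_eq_square algebra_simps)
  have "integrable \<mu> (\<lambda>x. (cmod (F x + H x))\<^sup>2)"
    unfolding eq using assms in_L2_mult[OF assms]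
    by (intro Bochner_Integration.integrable_add integrable_mult_right integrable_Re) (simp_all add: in_L2_def)
  then show ?thesis by (simp add: in_L2_def)
qed

lemma in_L2_scale:
  assumes "in_L2 \<mu> F"
  shows "in_L2 \<mu> (\<lambda>x. c * F x)"
  using assms by (auto simp: in_L2_def norm_mult power_mult_distrib)

lemma L2_inner_cnj: "L2_inner \<mu> F H = cnj (L2_inner \<mu> H F)"
proof -
  have "cnj (L2_inner \<mu> H F) = (LINT x|\<mu>. cnj (H x * cnj (F x)))"
    unfolding L2_inner_def by (rule Bochner_Integration.integral_cnj[symmetric])
  also have "(\<lambda>x. cnj (H x * cnj (F x))) = (\<lambda>x. F x * cnj (H x))" by (simp add: mult.commute)
  finally show ?thesis by (simp add: L2_inner_def)
qed

lemma L2_inner_add_left: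
  assumes "in_L2 \<mu> F1" "in_L2 \<mu> F2" "in_L2 \<mu> H"
  shows "L2_inner \<mu> (\<lambda>x. F1 x + F2 x) H = L2_inner \<mu> F1 H + L2_inner \<mu> F2 H"
  unfolding L2_inner_def distrib_right
  by (rule Bochner_Integration.integral_add) (simp_all add: in_L2_mult assms)

lemma L2_inner_add_right:
  assumes "in_L2 \<mu> F1" "in_L2 \<mu> F2" "in_L2 \<mu> H"
  shows "L2_inner \<mu> H (\<lambda>x. F1 x + F2 x) = L2_inner \<mu> H F1 + L2_inner \<mu> H F2"
  unfolding L2_inner_cnj[of \<mu> H] by (simp add: L2_inner_add_left assms)

lemma L2_inner_scale_left: "L2_inner \<mu> (\<lambda>x. c * F x) H = c * L2_inner \<mu> F H"
  unfolding L2_inner_def by (simp add: mult.assoc)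

lemma L2_inner_scale_right: "L2_inner \<mu> F (\<lambda>x. c * H x) = cnj c * L2_inner \<mu> F H"
  unfolding L2_inner_cnj[of \<mu> F] by (simp add: L2_inner_scale_left)

lemma L2_inner_self: "L2_inner \<mu> F F = complex_of_real (LINT x|\<mu>. (cmod (F x))\<^sup>2)"
  unfolding L2_inner_def complex_norm_square[symmetric] of_real_power[symmetric]
  by (rule integral_complex_of_real)

lemma L2_Fatou:
  assumes L2: "\<And>n. in_L2 \<mu> (F n)" and m: "H \<in> borel_measurable \<mu>"
    and lim: "\<And>x. (\<lambda>n. F n x) \<longlonglongrightarrow> H x"
    and le: "\<And>n. (LINT x|\<mu>. (cmod (F n x))\<^sup>2) \<le> a n" and a: "a \<longlonglongrightarrow> A"
  shows "in_L2 \<mu> H \<and> (LINT x|\<mu>. (cmod (H x))\<^sup>2) \<le> A"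
proof -
  have [measurable]: "H \<in> borel_measurable \<mu>" "F n \<in> borel_measurable \<mu>" for n
    using m L2 by (simp_all add: in_L2_def)
  have pt: "liminf (\<lambda>n. ennreal ((cmod (F n x))\<^sup>2)) = ennreal ((cmod (H x))\<^sup>2)" for x
    by (rule lim_imp_Liminf[OF trivial_limit_sequentially
          tendsto_ennrealI[OF tendsto_power[OF tendsto_norm[OF lim]]]])
  have "(\<integral>\<^sup>+x. ennreal ((cmod (H x))\<^sup>2) \<partial>\<mu>)
      = (\<integral>\<^sup>+x. liminf (\<lambda>n. ennreal ((cmod (F n x))\<^sup>2)) \<partial>\<mu>)" by (simp only: pt)
  also have "\<dots> \<le> liminf (\<lambda>n. \<integral>\<^sup>+x. ennreal ((cmod (F n x))\<^sup>2) \<partial>\<mu>)"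
    by (rule nn_integral_liminf) measurable
  also have "\<dots> \<le> liminf (\<lambda>n. ennreal (a n))"
  proof (rule Liminf_mono, rule always_eventually, rule allI)
    fix n
    have "(\<integral>\<^sup>+x. ennreal ((cmod (F n x))\<^sup>2) \<partial>\<mu>) = ennreal (LINT x|\<mu>. (cmod (F n x))\<^sup>2)"
      by (rule nn_integral_eq_integral) (use L2 in \<open>auto simp: in_L2_def\<close>)
    also have "\<dots> \<le> ennreal (a n)" by (rule ennreal_leI[OF le])
    finally show "(\<integral>\<^sup>+x. ennreal ((cmod (F n x))\<^sup>2) \<partial>\<mu>) \<le> ennreal (a n)" .
  qed
  also have "\<dots> = ennreal A"
    by (rule lim_imp_Liminf[OF trivial_limit_sequentially tendsto_ennrealI[OF a]])
  finally have H: "(\<integral>\<^sup>+x. ennreal ((cmod (H x))\<^sup>2) \<partial>\<mu>) \<le> ennreal A" .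
  have A: "0 \<le> A"
  proof (rule LIMSEQ_le_const[OF a], intro exI[of _ 0] allI impI)
    show "0 \<le> a n" for n
      by (rule order_trans[OF Bochner_Integration.integral_nonneg le]) simp
  qed
  have int: "integrable \<mu> (\<lambda>x. (cmod (H x))\<^sup>2)"
  proof (rule integrableI_bounded)
    show "(\<integral>\<^sup>+x. ennreal (norm ((cmod (H x))\<^sup>2)) \<partial>\<mu>) < \<infinity>"
      using le_less_trans[OF H ennreal_less_top] by simp
  qed measurable
  have "ennreal (LINT x|\<mu>. (cmod (H x))\<^sup>2) \<le> ennreal A"
    using H unfolding nn_integral_eq_integral[OF int AE_I2[OF zero_le_power2]] .
  then show ?thesis using A int by (simp add: in_L2_def ennreal_le_iff)
qed

lemma L2_inner_invariant:
  assumes [measurable]: "T \<in> measurable \<mu> borel" and inv: "distr \<mu> borel T = \<mu>"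
    and [measurable]: "F \<in> borel_measurable borel" "H \<in> borel_measurable borel"
  shows "L2_inner \<mu> (\<lambda>x. F (T x)) (\<lambda>x. H (T x)) = L2_inner \<mu> F H"
proof -
  have "L2_inner \<mu> F H = (LINT x|distr \<mu> borel T. F x * cnj (H x))"
    by (simp add: inv L2_inner_def)
  also have "\<dots> = (LINT x|\<mu>. F (T x) * cnj (H (T x)))"
    by (rule integral_distr) (intro assms borel_measurable_times borel_measurable_cnj)+
  finally show ?thesis by (simp add: L2_inner_def)
qed

section \<open>Equivariant transforms\<close>

text \<open>
  The form \<open>b u w = Re \<langle>V u, V w\<rangle>\<close> on the vectors that \<open>V\<close> sends into \<open>L\<^sup>2\<close> is invariant because
  every \<open>\<tau> y\<close> preserves the measure, and closed by Fatou's lemma because \<open>V\<close> is pointwise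
  continuous. The function \<open>s\<close>, the identity or conjugation, covers linear and antilinear \<open>V\<close>
  simultaneously: the wavelet transform is linear in the signal and antilinear in the window.
\<close>

theorem equivariant_transform_multiple_of_isometry:
  fixes \<mu> :: "'g::{topological_group_add,t2_space} measure"
    and \<pi> :: "'g \<Rightarrow> 'h \<Rightarrow> 'h::chilbert_space"
    and V :: "'h \<Rightarrow> 'g \<Rightarrow> complex"
  assumes rep: "unitary_rep \<pi>" and irr: "irreducible_rep \<pi>"
    and sets: "sets \<mu> = sets borel"
    and V_add: "\<And>u v. V (u + v) = (\<lambda>x. V u x + V v x)"
    and V_scaleC: "\<And>c u. V (c *\<^sub>C u) = (\<lambda>x. s c * V u x)"
    and s_real: "\<And>r. s (complex_of_real r) = complex_of_real r"
    and s_cnj: "\<And>c. s (cnj c) = cnj (s c)"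
    and V_cont: "\<And>u. continuous_on UNIV (V u)"
    and V_lim: "\<And>X l x. X \<longlonglongrightarrow> l \<Longrightarrow> (\<lambda>n. V (X n) x) \<longlonglongrightarrow> V l x"
    and V_pi: "\<And>y u. V (\<pi> y u) = (\<lambda>x. V u (\<tau> y x))"
    and tau: "\<And>y. continuous_on UNIV (\<tau> y)" "\<And>y. distr \<mu> borel (\<tau> y) = \<mu>"
    and f0: "f0 \<noteq> 0" "in_L2 \<mu> (V f0)"
  shows "(\<forall>f. in_L2 \<mu> (V f)) \<and> (\<exists>k. \<forall>f. (LINT x|\<mu>. (cmod (V f x))\<^sup>2) = k * (norm f)\<^sup>2)"
proof -
  define D where "D = {u. in_L2 \<mu> (V u)}"
  define b where "b u w = Re (L2_inner \<mu> (V u) (V w))" for u w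
  have V_borel: "V u \<in> borel_measurable borel" for u
    by (rule borel_measurable_continuous_onI[OF V_cont])
  have V_meas: "V u \<in> borel_measurable \<mu>" for u
    using V_borel by (simp cong: measurable_cong_sets add: sets)
  have tau_meas: "\<tau> y \<in> measurable \<mu> borel" for y
    using borel_measurable_continuous_onI[OF tau(1)[of y]] by (simp cong: measurable_cong_sets add: sets)
  have V_scaleR: "V (r *\<^sub>R u) = (\<lambda>x. complex_of_real r * V u x)" for r u
    using V_scaleC[of "complex_of_real r" u] by (simp add: scaleC_of_real s_real)
  have D_scaleC: "c *\<^sub>C u \<in> D" if "u \<in> D" for c u
    using that by (simp add: D_def V_scaleC in_L2_scale)
  have invariant: "L2_inner \<mu> (V (\<pi> y u)) (V (\<pi> y w)) = L2_inner \<mu> (V u) (V w)" for y u w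
    unfolding V_pi by (rule L2_inner_invariant[OF tau_meas tau(2) V_borel V_borel])
  have D_pi: "\<pi> y u \<in> D" if "u \<in> D" for y u
  proof -
    have "integrable \<mu> (\<lambda>x. (cmod (V u x))\<^sup>2)" using that by (simp add: D_def in_L2_def)
    then have "integrable (distr \<mu> borel (\<tau> y)) (\<lambda>x. (cmod (V u x))\<^sup>2)" by (simp only: tau(2))
    then have "integrable \<mu> (\<lambda>x. (cmod (V u (\<tau> y x)))\<^sup>2)"
      by (rule integrable_distr[OF tau_meas])
    then show ?thesis using V_meas[of "\<pi> y u"] by (simp add: D_def in_L2_def V_pi)
  qed
  have form: "closed_form D b"
  proof
    show "subspace D"
      by (rule subspaceI)
        (use in_L2_scale[OF f0(2), of 0] V_scaleC[of 0 f0] s_real[of 0] in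
          \<open>auto simp: D_def V_add V_scaleR in_L2_add in_L2_scale\<close>)
    show "b (u + v) w = b u w + b v w" if "u \<in> D" "v \<in> D" "w \<in> D" for u v w
      using that by (simp add: b_def V_add D_def L2_inner_add_left)
    show "b (r *\<^sub>R u) w = r * b u w" for r u w
      by (simp add: b_def V_scaleR L2_inner_scale_left)
    show "b u w = b w u" for u w
      unfolding b_def by (subst L2_inner_cnj) simp
    show "0 \<le> b u u" for u
      by (simp add: b_def L2_inner_self)
    show "l \<in> D \<and> b l l \<le> A"
      if "\<And>n. X n \<in> D" "X \<longlonglongrightarrow> l" "\<And>n. b (X n) (X n) \<le> a n" "a \<longlonglongrightarrow> A" for X l a A
      using L2_Fatou[of \<mu> "\<lambda>n. V (X n)" "V l" a A] that V_meas V_lim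
      by (simp add: b_def D_def L2_inner_self)
  qed
  have "D = UNIV \<and> (\<exists>k. \<forall>f. b f f = k * (norm f)\<^sup>2)"
  proof (rule invariant_closed_form_scalar[OF form rep irr D_pi D_scaleC _ _ _ f0(1)])
    show "b (\<pi> y u) w = b u (\<pi> (- y) w)" for y u w
      using invariant[of y u "\<pi> (- y) w"] by (simp add: b_def unitary_rep_uminus[OF rep])
    show "b (c *\<^sub>C u) w = b u (cnj c *\<^sub>C w)" for c u w
      by (simp add: b_def V_scaleC s_cnj L2_inner_scale_left L2_inner_scale_right)
    show "f0 \<in> D" using f0(2) by (simp add: D_def)
  qed
  then show ?thesis by (auto simp: D_def b_def L2_inner_self)
qed

section \<open>Orthogonality relations\<close>

lemma left_haar_measureD:
  assumes "left_haar_measure \<mu>"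
  shows "sets \<mu> = sets borel" and "emeasure \<mu> UNIV \<noteq> 0"
    and "distr \<mu> borel (\<lambda>x. a + x) = \<mu>"
    and "open U \<Longrightarrow> emeasure \<mu> U = (SUP K \<in> {K. compact K \<and> K \<subseteq> U}. emeasure \<mu> K)"
proof -
  note haar = assms[unfolded left_haar_measure_def]
  show "sets \<mu> = sets borel" by (rule haar[THEN conjunct1])
  show "emeasure \<mu> UNIV \<noteq> 0" by (rule haar[THEN conjunct2, THEN conjunct1])
  show "distr \<mu> borel (\<lambda>x. a + x) = \<mu>"
    by (rule haar[THEN conjunct2, THEN conjunct2, THEN conjunct1, THEN spec])
  show "open U \<Longrightarrow> emeasure \<mu> U = (SUP K \<in> {K. compact K \<and> K \<subseteq> U}. emeasure \<mu> K)"
    by (rule haar[THEN conjunct2, THEN conjunct2, THEN conjunct2, THEN conjunct2, THEN conjunct2,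
          THEN spec, THEN mp])
qed

text \<open>
  Translates of a nonempty open null set would cover the group. Every compact set would be null
  by a finite subcover, and by inner regularity so would be the whole group.
\<close>

lemma open_Haar_null_empty:
  fixes \<mu> :: "'g::{topological_group_add,t2_space} measure"
  assumes haar: "left_haar_measure \<mu>" and U: "open U" "emeasure \<mu> U = 0"
  shows "U = {}"
proof (rule ccontr)
  assume "U \<noteq> {}"
  then obtain u where u: "u \<in> U" by blast
  note sets = left_haar_measureD(1)[OF haar] and inv = left_haar_measureD(3)[OF haar]
  have space: "space \<mu> = UNIV" using sets_eq_imp_space_eq[OF sets] by simp
  define W where "W a = (\<lambda>x. a + x) -` U" for a
  have cont: "continuous_on UNIV (\<lambda>x. a + x)" for a :: 'g by (intro continuous_intros)
  have meas: "(\<lambda>x. a + x) \<in> measurable \<mu> borel" for a :: 'g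
    using borel_measurable_continuous_onI[OF cont[of a]] by (simp cong: measurable_cong_sets add: sets)
  have W_open: "open (W a)" for a
    unfolding W_def by (rule open_vimage[OF U(1) cont])
  have W0: "W a \<in> null_sets \<mu>" for a
  proof (rule null_setsI)
    have "emeasure \<mu> U = emeasure (distr \<mu> borel (\<lambda>x. a + x)) U" by (simp only: inv)
    also have "\<dots> = emeasure \<mu> (W a)"
      by (subst emeasure_distr[OF meas]) (use U in \<open>auto simp: W_def space\<close>)
    finally show "emeasure \<mu> (W a) = 0" using U(2) by simp
    show "W a \<in> sets \<mu>" using W_open by (simp add: sets)
  qed
  have "emeasure \<mu> K = 0" if K: "compact K" for K
  proof -
    have "K \<subseteq> (\<Union>a\<in>UNIV. W a)"
    proof
      fix x
      have "x \<in> W (u - x)" using u by (simp add: W_def)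
      then show "x \<in> (\<Union>a\<in>UNIV. W a)" by blast
    qed
    then obtain I where I: "I \<subseteq> UNIV" "finite I" "K \<subseteq> (\<Union>a\<in>I. W a)"
      by (rule compactE_image[OF K W_open])
    have "(\<Union>a\<in>I. W a) \<in> null_sets \<mu>"
      using I(2) W0 by (intro null_sets_UN' countable_finite)
    then show ?thesis using emeasure_eq_0[OF null_setsD2 null_setsD1 I(3)] by simp
  qed
  then have "(SUP K \<in> {K. compact K \<and> K \<subseteq> UNIV}. emeasure \<mu> K) = 0"
    by (intro SUP_eq_const) auto
  then show False
    using left_haar_measureD(4)[OF haar open_UNIV] left_haar_measureD(2)[OF haar] by simp
qed

text \<open>
  For a square integrable vector \<open>h\<close>, left invariance makes \<open>f \<mapsto> W\<^sub>h f\<close> a multiple of an isometry; in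
  particular every \<open>W\<^sub>h f\<close> is in \<open>L\<^sup>2\<close>. This is the starting point required for the antilinear map
  \<open>g \<mapsto> W\<^sub>g f\<close> with \<open>f\<close> fixed, to which right invariance applies. Comparing both formulas at
  \<open>g = h\<close> identifies the constant. It is positive because \<open>W\<^sub>h h\<close> is continuous and nonzero at the
  identity, and nonempty open sets have positive measure.
\<close>

theorem unimodular_norm_relation:
  fixes \<mu> :: "'g::{topological_group_add,t2_space} measure"
    and \<pi> :: "'g \<Rightarrow> 'h \<Rightarrow> 'h::chilbert_space"
  assumes haar: "left_haar_measure \<mu>" and uni: "unimodular \<mu>"
    and sq: "square_integrable_rep \<mu> \<pi>"
  shows "\<exists>d>0. \<forall>f g. in_L2 \<mu> (wavelet \<pi> g f) \<and>
    (LINT x|\<mu>. (cmod (wavelet \<pi> g f x))\<^sup>2) = d * (norm f)\<^sup>2 * (norm g)\<^sup>2"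
proof -
  note sets = left_haar_measureD(1)[OF haar] and left = left_haar_measureD(3)[OF haar]
  have right: "\<And>a. distr \<mu> borel (\<lambda>x. x + a) = \<mu>" using uni unfolding unimodular_def by blast
  have rep: "unitary_rep \<pi>" and irr: "irreducible_rep \<pi>"
    using sq unfolding square_integrable_rep_def by blast+
  obtain h where h: "h \<noteq> 0" "in_L2 \<mu> (wavelet \<pi> h h)"
    using sq unfolding square_integrable_rep_def square_integrable_vector_def by blast
  have U: "unitary_operator (\<pi> x)" and pi_comp: "\<pi> (x + y) = \<pi> x \<circ> \<pi> y"
    and W_cont: "continuous_on UNIV (wavelet \<pi> g f)" for x y f g
    using rep unfolding unitary_rep_def by blast+
  have pi_add: "\<pi> x (u + v) = \<pi> x u + \<pi> x v" and pi_scaleC: "\<pi> x (c *\<^sub>C u) = c *\<^sub>C \<pi> x u"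
    for x u v c
    using U unfolding unitary_operator_def by blast+
  have first: "(\<forall>f. in_L2 \<mu> (wavelet \<pi> h f)) \<and>
      (\<exists>k. \<forall>f. (LINT x|\<mu>. (cmod (wavelet \<pi> h f x))\<^sup>2) = k * (norm f)\<^sup>2)"
  proof (rule equivariant_transform_multiple_of_isometry[OF rep irr sets, where s = id and \<tau> = "\<lambda>y x. - y + x"])
    show "wavelet \<pi> h (u + v) = (\<lambda>x. wavelet \<pi> h u x + wavelet \<pi> h v x)" for u v
      by (simp add: wavelet_def cinner_add_left fun_eq_iff)
    show "wavelet \<pi> h (c *\<^sub>C u) = (\<lambda>x. id c * wavelet \<pi> h u x)" for c u
      by (simp add: wavelet_def cinner_scaleC_left fun_eq_iff)
    show "wavelet \<pi> h (\<pi> y u) = (\<lambda>x. wavelet \<pi> h u (- y + x))" for y u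
      by (simp add: wavelet_def pi_comp unitary_rep_adjoint[OF rep] fun_eq_iff)
    show "(\<lambda>n. wavelet \<pi> h (X n) x) \<longlonglongrightarrow> wavelet \<pi> h l x" if "X \<longlonglongrightarrow> l" for X l x
      unfolding wavelet_def by (rule bounded_linear.tendsto[OF bounded_linear_cinner_left that])
    show "continuous_on UNIV (\<lambda>x. - y + x)" for y :: 'g by (intro continuous_intros)
    show "h \<noteq> 0" "in_L2 \<mu> (wavelet \<pi> h h)" by (rule h)+
  qed (simp_all add: W_cont left)
  have second: "(\<forall>g. in_L2 \<mu> (wavelet \<pi> g f)) \<and>
      (\<exists>k. \<forall>g. (LINT x|\<mu>. (cmod (wavelet \<pi> g f x))\<^sup>2) = k * (norm g)\<^sup>2)" for f
  proof (rule equivariant_transform_multiple_of_isometry[OF rep irr sets, where s = cnj and \<tau> = "\<lambda>y x. x + y"])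
    show "wavelet \<pi> (u + v) f = (\<lambda>x. wavelet \<pi> u f x + wavelet \<pi> v f x)" for u v
      by (simp add: wavelet_def cinner_add_right pi_add fun_eq_iff)
    show "wavelet \<pi> (c *\<^sub>C u) f = (\<lambda>x. cnj c * wavelet \<pi> u f x)" for c u
      by (simp add: wavelet_def cinner_scaleC_right pi_scaleC fun_eq_iff)
    show "wavelet \<pi> (\<pi> y u) f = (\<lambda>x. wavelet \<pi> u f (x + y))" for y u
      by (simp add: wavelet_def pi_comp fun_eq_iff)
    show "(\<lambda>n. wavelet \<pi> (X n) f x) \<longlonglongrightarrow> wavelet \<pi> l f x" if "X \<longlonglongrightarrow> l" for X l x
      unfolding wavelet_def
      by (rule bounded_linear.tendsto[OF bounded_linear_cinner_right
            bounded_linear.tendsto[OF bounded_linear_unitary_operator[OF U] that]])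
    show "continuous_on UNIV (\<lambda>x. x + y)" for y :: 'g by (intro continuous_intros)
    show "h \<noteq> 0" by (rule h)
    show "in_L2 \<mu> (wavelet \<pi> h f)" using first by blast
  qed (simp_all add: W_cont right)
  define N where "N g f = (LINT x|\<mu>. (cmod (wavelet \<pi> g f x))\<^sup>2)" for g f
  obtain k where k: "N h f = k * (norm f)\<^sup>2" for f using first unfolding N_def by blast
  have "\<forall>f. \<exists>k. \<forall>g. N g f = k * (norm g)\<^sup>2" using second unfolding N_def by blast
  then obtain k' where k': "N g f = k' f * (norm g)\<^sup>2" for g f by metis
  define d where "d = k / (norm h)\<^sup>2"
  have d: "N g f = d * (norm f)\<^sup>2 * (norm g)\<^sup>2" for g f
  proof -
    have "k' f * (norm h)\<^sup>2 = k * (norm f)\<^sup>2" using k[of f] k'[of h f] by simp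
    then have "k' f = d * (norm f)\<^sup>2" using h(1) by (simp add: d_def field_simps)
    then show ?thesis by (simp add: k')
  qed
  have "d \<ge> 0"
  proof -
    have "0 \<le> N h h" unfolding N_def by simp
    then show ?thesis using h(1) unfolding d by (simp add: zero_le_mult_iff)
  qed
  moreover have "d \<noteq> 0"
  proof
    assume "d = 0"
    then have "(LINT x|\<mu>. (cmod (wavelet \<pi> h h x))\<^sup>2) = 0" using d[of h h] by (simp add: N_def)
    then have AE: "AE x in \<mu>. (cmod (wavelet \<pi> h h x))\<^sup>2 = 0"
      using h(2) by (subst (asm) integral_nonneg_eq_0_iff_AE) (auto simp: in_L2_def)
    define U where "U = (wavelet \<pi> h h) -` (- {0})"
    have "open U" unfolding U_def by (rule open_vimage[OF _ W_cont]) (simp add: open_Compl)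
    moreover have "emeasure \<mu> U = 0"
      by (rule iffD1[OF AE_iff_measurable AE])
        (use \<open>open U\<close> sets sets_eq_imp_space_eq[OF sets] in \<open>auto simp: U_def\<close>)
    ultimately have "U = {}" by (rule open_Haar_null_empty[OF haar])
    then have "wavelet \<pi> h h 0 = 0" unfolding U_def by auto
    then show False using h(1) by (simp add: wavelet_def unitary_rep_zero[OF rep] cinner_self)
  qed
  ultimately show ?thesis using d second unfolding N_def by (intro exI[of _ d]) auto
qed

text \<open>
  Both sides are sesquilinear in \<open>(f1, f2)\<close> and in \<open>(g2, g1)\<close>, so the norm relation polarizes
  first in the signals and then in the windows.
\<close>

theorem unimodular_orthogonality_relations:
  fixes \<mu> :: "'g::{topological_group_add,t2_space} measure"
    and \<pi> :: "'g \<Rightarrow> 'h \<Rightarrow> 'h::chilbert_space"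
  assumes haar: "left_haar_measure \<mu>" and uni: "unimodular \<mu>"
    and sq: "square_integrable_rep \<mu> \<pi>"
  shows "\<exists>d>0. (\<forall>f g. in_L2 \<mu> (wavelet \<pi> g f)) \<and>
    (\<forall>f1 f2 g1 g2. L2_inner \<mu> (wavelet \<pi> g1 f1) (wavelet \<pi> g2 f2)
      = complex_of_real d * cinner f1 f2 * cnj (cinner g1 g2))"
proof -
  obtain d where d: "0 < d" and L2: "\<And>f g. in_L2 \<mu> (wavelet \<pi> g f)"
    and norm: "\<And>f g. (LINT x|\<mu>. (cmod (wavelet \<pi> g f x))\<^sup>2) = d * (norm f)\<^sup>2 * (norm g)\<^sup>2"
    using unimodular_norm_relation[OF assms] by blast
  have rep: "unitary_rep \<pi>" using sq unfolding square_integrable_rep_def by blast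
  have U: "unitary_operator (\<pi> x)" for x using rep unfolding unitary_rep_def by blast
  have pi_add: "\<pi> x (u + v) = \<pi> x u + \<pi> x v" and pi_scaleC: "\<pi> x (c *\<^sub>C u) = c *\<^sub>C \<pi> x u"
    for x u v c
    using U unfolding unitary_operator_def by blast+
  have W: "wavelet \<pi> g (u + v) = (\<lambda>x. wavelet \<pi> g u x + wavelet \<pi> g v x)"
    "wavelet \<pi> g (c *\<^sub>C u) = (\<lambda>x. c * wavelet \<pi> g u x)"
    "wavelet \<pi> (u + v) f = (\<lambda>x. wavelet \<pi> u f x + wavelet \<pi> v f x)"
    "wavelet \<pi> (c *\<^sub>C u) f = (\<lambda>x. cnj c * wavelet \<pi> u f x)" for u v c f g
    by (simp_all add: wavelet_def cinner_add_left cinner_scaleC_left cinner_add_right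
        cinner_scaleC_right pi_add pi_scaleC fun_eq_iff)
  note bilinear = W L2_inner_add_left[OF L2 L2 L2] L2_inner_add_right[OF L2 L2 L2]
    L2_inner_scale_left L2_inner_scale_right cinner_add_left cinner_add_right
    cinner_scaleC_left cinner_scaleC_right
  have same_g: "L2_inner \<mu> (wavelet \<pi> g f1) (wavelet \<pi> g f2) - complex_of_real d * cinner f1 f2 * cinner g g = 0"
    for f1 f2 g
    by (rule sesquilinear_zero_of_zero_diagonal[of
          "\<lambda>f1 f2. L2_inner \<mu> (wavelet \<pi> g f1) (wavelet \<pi> g f2) - complex_of_real d * cinner f1 f2 * cinner g g"])
      (simp_all add: bilinear L2_inner_self norm cinner_self algebra_simps)
  have "L2_inner \<mu> (wavelet \<pi> g1 f1) (wavelet \<pi> g2 f2) - complex_of_real d * cinner f1 f2 * cinner g2 g1 = 0"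
    for f1 f2 g1 g2
    by (rule sesquilinear_zero_of_zero_diagonal[of
          "\<lambda>g2 g1. L2_inner \<mu> (wavelet \<pi> g1 f1) (wavelet \<pi> g2 f2) - complex_of_real d * cinner f1 f2 * cinner g2 g1"])
      (simp_all only: same_g, simp_all add: bilinear algebra_simps)
  then have "L2_inner \<mu> (wavelet \<pi> g1 f1) (wavelet \<pi> g2 f2) = complex_of_real d * cinner f1 f2 * cnj (cinner g1 g2)"
    for f1 f2 g1 g2
    using cinner_commute[of g2 g1] by simp
  then show ?thesis using d L2 by blast
qed

text \<open>
  A Duflo--Moore operator \<open>C\<close> satisfies \<open>\<langle>C u, C v\<rangle> = d \<langle>u, v\<rangle>\<close> and is symmetric, so \<open>C\<^sup>2 = d\<close>. With
  \<open>s = sqrt d\<close>, the vector \<open>v = C g - s g\<close> satisfies \<open>C v = - s v\<close>, which contradicts positivity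
  unless \<open>v = 0\<close>. Hence \<open>C = s\<close> is the only candidate, and it has all the required properties.
\<close>

lemma unimodular_duflo_moore:
  fixes \<mu> :: "'g::{topological_group_add,t2_space} measure"
    and \<pi> :: "'g \<Rightarrow> 'h \<Rightarrow> 'h::chilbert_space"
  assumes sq: "square_integrable_rep \<mu> \<pi>" and d: "0 < d"
    and L2: "\<And>f g. in_L2 \<mu> (wavelet \<pi> g f)"
    and orth: "\<And>f1 f2 g1 g2. L2_inner \<mu> (wavelet \<pi> g1 f1) (wavelet \<pi> g2 f2)
      = complex_of_real d * cinner f1 f2 * cnj (cinner g1 g2)"
  shows "duflo_moore \<mu> \<pi> = (\<lambda>g. sqrt d *\<^sub>R g)"
proof -
  define s where "s = sqrt d"
  have s: "0 < s" "s * s = d" using d by (simp_all add: s_def)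
  have D: "duflo_moore_domain \<mu> \<pi> = UNIV"
    using L2 by (auto simp: duflo_moore_domain_def square_integrable_vector_def)
  obtain h :: 'h where h: "h \<noteq> 0"
    using sq unfolding square_integrable_rep_def square_integrable_vector_def by blast
  have "is_duflo_moore \<mu> \<pi> (\<lambda>g. s *\<^sub>R g)"
    unfolding is_duflo_moore_def Let_def D
  proof (intro conjI allI ballI)
    show "positive_operator_on UNIV (\<lambda>g::'h. s *\<^sub>R g)"
      using s(1) unfolding positive_operator_on_def csubspace_def
      by (simp add: scaleR_add_right scaleC_scaleR cinner_scaleR_left cinner_scaleR_right cinner_self)
    show "inj_on (\<lambda>g::'h. s *\<^sub>R g) UNIV" using s(1) by (simp add: inj_on_def)
    show "L2_inner \<mu> (wavelet \<pi> g1 f1) (wavelet \<pi> g2 f2)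
        = cinner f1 f2 * cnj (cinner (s *\<^sub>R g1) (s *\<^sub>R g2))" for f1 f2 g1 g2
      by (simp add: orth cinner_scaleR_left cinner_scaleR_right scaleR_conv_of_real flip: s(2))
  qed (rule L2)
  moreover have "C = (\<lambda>g. s *\<^sub>R g)" if C: "is_duflo_moore \<mu> \<pi> C" for C
  proof
    fix g
    have pos: "positive_operator_on UNIV C"
      and CC: "\<And>f1 f2 g1 g2. L2_inner \<mu> (wavelet \<pi> g1 f1) (wavelet \<pi> g2 f2)
        = cinner f1 f2 * cnj (cinner (C g1) (C g2))"
      using C unfolding is_duflo_moore_def Let_def D by blast+
    have sym: "cinner (C u) v = cinner u (C v)" and add: "C (u + v) = C u + C v"
      and scale: "C (c *\<^sub>C u) = c *\<^sub>C C u" and nonneg: "0 \<le> Re (cinner (C u) u)" for u v c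
      using pos unfolding positive_operator_on_def by blast+
    have C2: "cinner (C u) (C v) = complex_of_real d * cinner u v" for u v
    proof -
      have "cinner h h * cnj (cinner (C u) (C v)) = cinner h h * cnj (complex_of_real d * cinner u v)"
        by (simp only: CC[symmetric] orth complex_cnj_mult complex_cnj_complex_of_real mult_ac)
      moreover have "cinner h h \<noteq> 0" using h by (simp add: cinner_self)
      ultimately show ?thesis by (metis complex_cnj_cancel_iff mult_cancel_left)
    qed
    define w where "w = C (C g) - d *\<^sub>R g"
    have "inner w w = Re (cinner (C (C g)) w) - d * inner g w"
      unfolding Re_cinner by (simp add: w_def inner_diff_left)
    also have "cinner (C (C g)) w = complex_of_real d * cinner g w" by (simp add: sym C2[symmetric])
    finally have "inner w w = 0" by (simp flip: Re_cinner)
    then have CCg: "C (C g) = d *\<^sub>R g" by (simp add: w_def)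
    define v where "v = C g - s *\<^sub>R g"
    have scaleR: "C (r *\<^sub>R u) = r *\<^sub>R C u" for r u
      using scale[of "complex_of_real r" u] by (simp add: scaleC_of_real)
    have "C v = - (s *\<^sub>R v)"
    proof -
      have "C v = C (C g + (- s) *\<^sub>R g)" by (simp add: v_def)
      also have "\<dots> = d *\<^sub>R g + (- s) *\<^sub>R C g" by (simp only: add scaleR CCg)
      also have "\<dots> = - (s *\<^sub>R v)" by (simp add: v_def scaleR_diff_right s(2))
      finally show ?thesis .
    qed
    then have "0 \<le> - (s * inner v v)" using nonneg[of v] by (simp add: Re_cinner)
    then have "inner v v = 0" using s(1) inner_ge_zero[of v]
      by (simp add: mult_le_0_iff)
    then show "C g = s *\<^sub>R g" by (simp add: v_def)
  qed
  ultimately have "duflo_moore \<mu> \<pi> = (\<lambda>g. s *\<^sub>R g)"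
    unfolding duflo_moore_def by (rule the_equality)
  then show ?thesis by (simp add: s_def)
qed

theorem corollary1p3:
  fixes \<mu> :: "'g::{topological_group_add,t2_space} measure"
    and \<pi> :: "'g \<Rightarrow> 'h \<Rightarrow> 'h::chilbert_space"
    and g g1 g2 :: 'h
    and t :: real
  assumes "locally_compact_space (euclidean :: 'g topology)"
    and "left_haar_measure \<mu>"
    and "unimodular \<mu>"
    and "square_integrable_rep \<mu> \<pi>"
    and "admissible \<mu> \<pi> g" and "admissible \<mu> \<pi> g1" and "admissible \<mu> \<pi> g2"
    and "0 \<le> t" and "t \<le> 1"
    and "wavelet \<pi> g g =
           (\<lambda>x. complex_of_real t * wavelet \<pi> g1 g1 x + complex_of_real (1 - t) * wavelet \<pi> g2 g2 x)"
  shows "((\<nexists>c. cmod c = 1 \<and> g1 = c *\<^sub>C g2) \<longrightarrow> t \<in> {0, 1}) \<and>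
         (\<exists>c. cmod c = 1 \<and> (g = c *\<^sub>C g1 \<or> g = c *\<^sub>C g2))"
proof -
  obtain d where d: "0 < d" and L2: "\<And>f g. in_L2 \<mu> (wavelet \<pi> g f)"
    and orth: "\<And>f1 f2 g1 g2. L2_inner \<mu> (wavelet \<pi> g1 f1) (wavelet \<pi> g2 f2)
      = complex_of_real d * cinner f1 f2 * cnj (cinner g1 g2)"
    using unimodular_orthogonality_relations[OF assms(2,3,4)] by blast
  define \<rho> where "\<rho> = 1 / sqrt d"
  have norm_eq: "norm u = \<rho>" if "admissible \<mu> \<pi> u" for u
    using that d unimodular_duflo_moore[OF assms(4) d L2 orth]
    by (simp add: admissible_def \<rho>_def field_simps)
  note norms = assms(5-7)[THEN norm_eq]
  have overlap: "L2_inner \<mu> (wavelet \<pi> u u) (wavelet \<pi> g g)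
      = complex_of_real (d * (cmod (cinner g u))\<^sup>2)" for u
  proof -
    have "cinner u g * cnj (cinner u g) = complex_of_real ((cmod (cinner g u))\<^sup>2)"
      by (simp only: complex_norm_square cinner_commute[of u g] complex_cnj_cnj mult.commute)
    then show ?thesis by (simp add: orth mult.assoc)
  qed
  have "L2_inner \<mu> (wavelet \<pi> g g) (wavelet \<pi> g g)
      = complex_of_real t * L2_inner \<mu> (wavelet \<pi> g1 g1) (wavelet \<pi> g g)
        + complex_of_real (1 - t) * L2_inner \<mu> (wavelet \<pi> g2 g2) (wavelet \<pi> g g)"
    by (subst (1) assms(10))
      (simp only: L2_inner_add_left[OF in_L2_scale[OF L2] in_L2_scale[OF L2] L2] L2_inner_scale_left)
  then have "complex_of_real (d * (cmod (cinner g g))\<^sup>2)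
      = complex_of_real (t * (d * (cmod (cinner g g1))\<^sup>2) + (1 - t) * (d * (cmod (cinner g g2))\<^sup>2))"
    unfolding overlap by simp
  then have "d * (cmod (cinner g g))\<^sup>2
      = t * (d * (cmod (cinner g g1))\<^sup>2) + (1 - t) * (d * (cmod (cinner g g2))\<^sup>2)"
    unfolding of_real_eq_iff .
  then have "d * (cmod (cinner g g))\<^sup>2
      = d * (t * (cmod (cinner g g1))\<^sup>2 + (1 - t) * (cmod (cinner g g2))\<^sup>2)"
    by (simp add: algebra_simps)
  moreover have "cmod (cinner g g) = \<rho> * \<rho>" by (simp add: cinner_self norms power2_eq_square norm_mult)
  ultimately have convex: "(\<rho> * \<rho>)\<^sup>2 = t * (cmod (cinner g g1))\<^sup>2 + (1 - t) * (cmod (cinner g g2))\<^sup>2"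
    using d by simp
  have le: "(cmod (cinner g u))\<^sup>2 \<le> (\<rho> * \<rho>)\<^sup>2" if "norm u = \<rho>" for u
    by (rule power_mono) (use norm_cinner_bound[of g u] that norms in auto)
  have parallel: "\<exists>c. cmod c = 1 \<and> g = c *\<^sub>C u"
    if "norm u = \<rho>" and "(cmod (cinner g u))\<^sup>2 = (\<rho> * \<rho>)\<^sup>2" for u
  proof (rule parallel_of_equality_in_Cauchy_Schwarz)
    show "norm g = norm u" using that norms by simp
    show "cmod (cinner g u) = norm g * norm u"
      using that(2) unfolding norms that(1) by (simp add: power2_eq_iff_nonneg)
  qed
  have g_g1: "\<exists>c. cmod c = 1 \<and> g = c *\<^sub>C g1" if "t > 0"
  proof (rule parallel[OF norms(2)])
    have "(1 - t) * (cmod (cinner g g2))\<^sup>2 \<le> (1 - t) * (\<rho> * \<rho>)\<^sup>2"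
      by (rule mult_left_mono[OF le[OF norms(3)]]) (use assms(9) in simp)
    then have "t * (\<rho> * \<rho>)\<^sup>2 \<le> t * (cmod (cinner g g1))\<^sup>2" using convex by (simp add: algebra_simps)
    then show "(cmod (cinner g g1))\<^sup>2 = (\<rho> * \<rho>)\<^sup>2"
      using that le[OF norms(2)] by (simp add: order_antisym)
  qed
  have g_g2: "\<exists>c. cmod c = 1 \<and> g = c *\<^sub>C g2" if "t < 1"
  proof (rule parallel[OF norms(3)])
    have "t * (cmod (cinner g g1))\<^sup>2 \<le> t * (\<rho> * \<rho>)\<^sup>2"
      by (rule mult_left_mono[OF le[OF norms(2)]]) (rule assms(8))
    then have "(1 - t) * (\<rho> * \<rho>)\<^sup>2 \<le> (1 - t) * (cmod (cinner g g2))\<^sup>2" using convex by (simp add: algebra_simps)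
    then show "(cmod (cinner g g2))\<^sup>2 = (\<rho> * \<rho>)\<^sup>2"
      using that le[OF norms(3)] by (simp add: order_antisym)
  qed
  have "t \<in> {0, 1}" if "\<nexists>c. cmod c = 1 \<and> g1 = c *\<^sub>C g2"
  proof (rule ccontr)
    assume "t \<notin> {0, 1}"
    then have "t > 0" "t < 1" using assms(8,9) by auto
    then obtain a b where a: "cmod a = 1" "g = a *\<^sub>C g1" and b: "cmod b = 1" "g = b *\<^sub>C g2"
      using g_g1 g_g2 by blast
    have "a \<noteq> 0" using a(1) by auto
    then have "g1 = (inverse a * a) *\<^sub>C g1" by simp
    also have "\<dots> = inverse a *\<^sub>C g" by (simp only: a(2) scaleC_scaleC)
    also have "\<dots> = (inverse a * b) *\<^sub>C g2" by (simp only: b(2) scaleC_scaleC)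
    finally have "g1 = (inverse a * b) *\<^sub>C g2" .
    moreover have "cmod (inverse a * b) = 1" using a(1) b(1) by (simp add: norm_mult norm_inverse)
    ultimately show False using that by blast
  qed
  moreover have "\<exists>c. cmod c = 1 \<and> (g = c *\<^sub>C g1 \<or> g = c *\<^sub>C g2)"
    using g_g1 g_g2 by (cases "t > 0") auto
  ultimately show ?thesis by blast
qed

end
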